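(* Let $T$ be an isotropic Gaussian random field on $\mathbb S^2$ with angular power spectrum $(A_\ell,\ell\in\mathbb N_0)$. If $A_\ell\le C\,\ell^{-\alpha}$ for all $\ell\in\mathbb N$, some $\alpha>2$ and some constant $C$, then there exists a modification of $\exp(T)$ that is Hölder continuous with exponent $\gamma$ for all $\gamma<(\alpha-2)/2$, $\gamma\le1$.
   Context: $\mathbb S^2$ is the unit sphere in $\mathbb R^3$ with geodesic metric $d(x,y)=\arccos\langle x,y\rangle_{\mathbb R^3}$. An isotropic Gaussian random field on $\mathbb S^2$ is a jointly measurable map $T:\Omega\times\mathbb S^2\to\mathbb R$ that is Gaussian (all finite-dimensional distributions are multivariate Gaussian) with mean and covariance invariant under rotations in $\mathrm{SO}(3)$. Its angular power spectrum is the sequence of nonnegative reals $(A_\ell,\ell\in\mathbb N_0)$ with $\mathrm{Cov}(T(x),T(y))=\sum_{\ell=0}^\infty A_\ell\frac{2\ell+1}{4\pi}P_\ell(\langle x,y\rangle_{\mathbb R^3})$, $P_\ell$ the Legendre polynomials. The lognormal random field $\exp(T)$ is $x\mapsto\exp(T(x))$. A modification of a random field $S$ is a random field $\tilde S$ with $\mathbb P(\tilde S(x)=S(x))=1$ for every $x\in\mathbb S^2$; Hölder continuity refers to its sample paths, with respect to $d$. *)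

theory Defs
  imports "HOL-Probability.Probability" "HOL-Computational_Algebra.Polynomial"
begin

type_synonym 'w sphere_field = "'w \<Rightarrow> real^3 \<Rightarrow> real"

text \<open>Fields are total functions on the ambient space; only their values on \<open>S2\<close> matter.\<close>

abbreviation S2 :: "(real^3) set"
  where "S2 \<equiv> sphere 0 1"

definition geodesic_dist :: "real^3 \<Rightarrow> real^3 \<Rightarrow> real"
  where "geodesic_dist x y = arccos (x \<bullet> y)"

definition random_field :: "'w measure \<Rightarrow> 'w sphere_field \<Rightarrow> bool"
  where "random_field M T \<longleftrightarrow>
    (\<lambda>(\<omega>, x). T \<omega> x) \<in> borel_measurable (M \<Otimes>\<^sub>M restrict_space borel S2)"

text \<open>Variance zero is allowed, a constant being a degenerate normal variable.  This is necessary
  for multivariate normality, where the covariance matrix may be singular.\<close>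

definition normal_rv :: "'w measure \<Rightarrow> ('w \<Rightarrow> real) \<Rightarrow> bool"
  where "normal_rv M X \<longleftrightarrow> X \<in> borel_measurable M \<and>
    (\<exists>\<mu>. (AE \<omega> in M. X \<omega> = \<mu>) \<or>
         (\<exists>\<sigma>>0. distributed M lborel X (\<lambda>t. ennreal (normal_density \<mu> \<sigma> t))))"

definition multivariate_gaussian :: "'w measure \<Rightarrow> nat \<Rightarrow> (nat \<Rightarrow> 'w \<Rightarrow> real) \<Rightarrow> bool"
  where "multivariate_gaussian M k X \<longleftrightarrow>
    (\<forall>a :: nat \<Rightarrow> real. normal_rv M (\<lambda>\<omega>. \<Sum>i<k. a i * X i \<omega>))"

definition gaussian_field :: "'w measure \<Rightarrow> 'w sphere_field \<Rightarrow> bool"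
  where "gaussian_field M T \<longleftrightarrow> random_field M T \<and>
    (\<forall>k (x :: nat \<Rightarrow> real^3). (\<forall>i<k. x i \<in> S2) \<longrightarrow> multivariate_gaussian M k (\<lambda>i \<omega>. T \<omega> (x i)))"

definition field_mean :: "'w measure \<Rightarrow> 'w sphere_field \<Rightarrow> real^3 \<Rightarrow> real"
  where "field_mean M T x = (LINT \<omega>|M. T \<omega> x)"

definition field_cov :: "'w measure \<Rightarrow> 'w sphere_field \<Rightarrow> real^3 \<Rightarrow> real^3 \<Rightarrow> real"
  where "field_cov M T x y =
    (LINT \<omega>|M. (T \<omega> x - field_mean M T x) * (T \<omega> y - field_mean M T y))"

definition isotropic_gaussian_field :: "'w measure \<Rightarrow> 'w sphere_field \<Rightarrow> bool"
  where "isotropic_gaussian_field M T \<longleftrightarrow> gaussian_field M T \<and>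
    (\<forall>g :: real^3^3. rotation_matrix g \<longrightarrow>
      (\<forall>x\<in>S2. field_mean M T (g *v x) = field_mean M T x) \<and>
      (\<forall>x\<in>S2. \<forall>y\<in>S2. field_cov M T (g *v x) (g *v y) = field_cov M T x y))"

text \<open>Rodrigues' formula.\<close>

definition legendre_poly :: "nat \<Rightarrow> real poly"
  where "legendre_poly l = smult (1 / (2 ^ l * fact l)) ((pderiv ^^ l) ([:-1, 0, 1:] ^ l))"

definition angular_power_spectrum :: "'w measure \<Rightarrow> 'w sphere_field \<Rightarrow> (nat \<Rightarrow> real) \<Rightarrow> bool"
  where "angular_power_spectrum M T A \<longleftrightarrow> (\<forall>l. 0 \<le> A l) \<and>
    (\<forall>x\<in>S2. \<forall>y\<in>S2.
      (\<lambda>l. A l * ((2 * real l + 1) / (4 * pi)) * poly (legendre_poly l) (x \<bullet> y))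
        sums field_cov M T x y)"

definition modification :: "'w measure \<Rightarrow> 'w sphere_field \<Rightarrow> 'w sphere_field \<Rightarrow> bool"
  where "modification M S S' \<longleftrightarrow> random_field M S' \<and>
    (\<forall>x\<in>S2. measure M {\<omega> \<in> space M. S' \<omega> x = S \<omega> x} = 1)"

definition hoelder_continuous :: "real \<Rightarrow> (real^3 \<Rightarrow> real) \<Rightarrow> bool"
  where "hoelder_continuous \<gamma> f \<longleftrightarrow>
    (\<exists>K. \<forall>x\<in>S2. \<forall>y\<in>S2. \<bar>f x - f y\<bar> \<le> K * geodesic_dist x y powr \<gamma>)"

end

theory Submission
  imports Defs
begin

text \<open>
  The exponent \<open>\<gamma> = 1\<close> is included when \<open>\<alpha> > 4\<close>, so Lipschitz paths have to be found.  The usual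
  Kolmogorov--Chentsov argument cannot give them: it works with \<open>T x - T y\<close>, whose variance is in
  general of order \<open>d x y ^ 2\<close> even for smooth fields, and it loses an arbitrarily small amount of the exponent.  The proof
  therefore works with the second-order increments \<open>T a + T b - 2 * T c\<close>, where \<open>c\<close> is nearly the
  midpoint of \<open>a\<close> and \<open>b\<close>, so that there is room above the exponent 1.

  \<^emph>\<open>Variance.\<close>  By the spectral expansion, the variance of the increment is the sum over \<open>l\<close> of
  \<open>A l * (2 * l + 1) / (4 * pi)\<close> times a combination of values of \<open>1 - P l\<close>.  If \<open>a\<close> and \<open>b\<close> have
  distance at most \<open>\<delta>\<close> from \<open>c\<close> and \<open>a + b - 2 c\<close> has norm at most \<open>\<delta> ^ 2\<close>, this combination is
  bounded by a multiple of \<open>min 1 ((l * \<delta>) ^ 4)\<close>: the contributions linear in \<open>1 - t\<close> from the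
  Taylor expansion of \<open>P l\<close> at 1 combine to a multiple of \<open>norm (a + b - 2 c) ^ 2\<close>
  (\<open>legendre_increment_le\<close>).  It is thus at most a multiple of \<open>(l * \<delta>) powr (2 * \<kappa>)\<close> for every
  \<open>\<kappa>\<close> in \<open>[0, 2]\<close>, and the decay of \<open>A\<close> makes the sum finite as soon as \<open>2 * \<kappa> < \<alpha> - 2\<close>
  (\<open>variance_increment_le\<close>).

  \<^emph>\<open>Probability.\<close>  The increments are centred and normal.  Markov's inequality for a sufficiently high
  even moment beats the number \<open>O (8 ^ n)\<close> of points in a bounded part of the grid of mesh \<open>2 ^ - n\<close>
  in space.  By Borel--Cantelli, almost surely all second differences of \<open>p \<mapsto> T (p / norm p)\<close> at grid
  points near the sphere are eventually at most \<open>2 powr (- \<kappa> * n)\<close>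
  (\<open>gaussian_array_eventually_small\<close>, \<open>AE_second_diff_small\<close>).  The radial extension spares the choice
  of charts: one grid serves the whole sphere, and the grid points that approximate a point of the
  sphere are found by rounding its coordinates.

  \<^emph>\<open>Deterministic part.\<close>  When the mesh is halved, a first difference is half of a coarser one up to
  second differences.  So a bound \<open>d n\<close> for the first differences satisfies
  \<open>d (n + 1) \<le> d n / 2 + 3 * b ^ (n + 1)\<close> with \<open>b = 2 powr - \<kappa>\<close>, and hence \<open>d n = O (2 powr (- \<gamma> * n))\<close>
  for every \<open>\<gamma> \<le> 1\<close> below \<open>\<kappa>\<close>, with \<open>\<gamma> = 1\<close> included (\<open>first_diff_geometric\<close>).  Chaining along the
  roundings of a point shows that the values there converge to a function that is Hoelder continuous
  with exponent \<open>\<gamma>\<close> (\<open>grid_limit_hoelder\<close>).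

  \<^emph>\<open>Modification.\<close>  This limit agrees almost surely with \<open>T x\<close> for each fixed \<open>x\<close>, again by the variance
  bound (\<open>AE_grid_floor_limit\<close>).  On a null set the modification is constant.  Since the limit is bounded
  on the compact sphere, its exponential inherits the Hoelder exponents.  Countably many \<open>\<kappa>\<close> suffice, so
  one modification serves all \<open>\<gamma>\<close>.
\<close>

section \<open>Legendre polynomials near the endpoint 1\<close>

lemma poly_pderiv_funpow_power_root:
  fixes c :: real
  shows "poly ((pderiv ^^ m) ([:-c, 1:] ^ m * w)) c = fact m * poly w c"
proof (induction m arbitrary: w)
  case 0
  then show ?case by simp
next
  case (Suc m)
  have "pderiv ([:-c, 1:] ^ Suc m * w)
      = [:-c, 1:] ^ m * (smult (of_nat (Suc m)) w + [:-c, 1:] * pderiv w)"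
    unfolding pderiv_mult pderiv_power_Suc by (simp add: pderiv_pCons algebra_simps smult_add_left)
  then have "poly ((pderiv ^^ Suc m) ([:-c, 1:] ^ Suc m * w)) c
      = poly ((pderiv ^^ m) ([:-c, 1:] ^ m * (smult (of_nat (Suc m)) w + [:-c, 1:] * pderiv w))) c"
    by (simp only: funpow_Suc_right o_apply)
  also have "\<dots> = fact m * poly (smult (of_nat (Suc m)) w + [:-c, 1:] * pderiv w) c"
    by (rule Suc.IH)
  finally show ?case by (simp add: algebra_simps)
qed

lemma legendre_at_1: "poly (legendre_poly l) 1 = 1"
proof -
  have "[:-1, 0, 1:] = [:-1, 1:] * [:1, 1:: real:]" by simp
  then have "[:-1, 0, 1:] ^ l = [:-1, 1:] ^ l * [:1, 1:: real:] ^ l"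
    by (simp only: power_mult_distrib)
  then have "poly ((pderiv ^^ l) ([:-1, 0, 1:: real:] ^ l)) 1 = fact l * 2 ^ l"
    using poly_pderiv_funpow_power_root[of l 1 "[:1, 1:] ^ l"] by simp
  then show ?thesis by (simp add: legendre_poly_def)
qed

lemma poly_pderiv_funpow_smult: "(pderiv ^^ n) (smult a p) = smult a ((pderiv ^^ n) (p :: real poly))"
  by (induction n) (simp_all add: pderiv_smult)

text \<open>For \<open>p = X ^ 2 - 1\<close>, \<open>q = X\<close> and \<open>u = p ^ l\<close> the base equation is the first-order differential
  equation of Rodrigues' polynomial; differentiating it \<open>k + 1\<close> times by Leibniz' rule gives the
  conclusion.\<close>
lemma pderiv_funpow_rodrigues:
  fixes k :: nat and l :: real and p q :: "real poly"
  assumes dp: "pderiv p = smult 2 q" and dq: "pderiv q = 1"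
    and base: "p * pderiv u = smult (2 * l) (q * u)"
  shows "p * (pderiv ^^ (k + 2)) u + smult (2 * (real k + 1) - 2 * l) (q * (pderiv ^^ (k + 1)) u)
      + smult ((real k + 1) * (real k - 2 * l)) ((pderiv ^^ k) u) = 0"
proof (induction k)
  case 0
  have "pderiv (p * pderiv u) = pderiv (smult (2 * l) (q * u))"
    by (simp only: base)
  then have "p * pderiv (pderiv u) + pderiv u * smult 2 q = smult (2 * l) (q * pderiv u + u * 1)"
    by (simp only: pderiv_mult pderiv_smult dp dq)
  then have *: "poly (p * pderiv (pderiv u) + pderiv u * smult 2 q) t
      = poly (smult (2 * l) (q * pderiv u + u * 1)) t" for t
    by (simp only:)
  show ?case
  proof (rule poly_eq_poly_eq_iff[THEN iffD1], rule ext)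
    fix t
    show "poly (p * (pderiv ^^ (0 + 2)) u + smult (2 * (real 0 + 1) - 2 * l) (q * (pderiv ^^ (0 + 1)) u)
      + smult ((real 0 + 1) * (real 0 - 2 * l)) ((pderiv ^^ 0) u)) t = poly 0 t"
      using *[of t] by (simp add: numeral_2_eq_2) (simp add: algebra_simps)
  qed
next
  case (Suc k)
  define D where "D i = (pderiv ^^ i) u" for i
  have D: "pderiv (D i) = D (Suc i)" for i by (simp add: D_def)
  have "pderiv (p * D (Suc (Suc k)) + smult (2 * (real k + 1) - 2 * l) (q * D (Suc k))
    + smult ((real k + 1) * (real k - 2 * l)) (D k)) = 0"
    using Suc.IH by (simp add: D_def)
  then have *: "poly (p * D (Suc (Suc (Suc k))) + D (Suc (Suc k)) * smult 2 q
      + smult (2 * (real k + 1) - 2 * l) (q * D (Suc (Suc k)) + D (Suc k) * 1)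
      + smult ((real k + 1) * (real k - 2 * l)) (D (Suc k))) t = 0" for t
    by (simp only: pderiv_add pderiv_mult pderiv_smult D dp dq poly_0)
  have "p * D (Suc (Suc (Suc k))) + smult (2 * (real (Suc k) + 1) - 2 * l) (q * D (Suc (Suc k)))
      + smult ((real (Suc k) + 1) * (real (Suc k) - 2 * l)) (D (Suc k)) = 0"
  proof (rule poly_eq_poly_eq_iff[THEN iffD1], rule ext)
    fix t
    define a b c where "a = poly (D (Suc k)) t" and "b = poly (D (Suc (Suc k))) t"
      and "c = poly (D (Suc (Suc (Suc k)))) t"
    show "poly (p * D (Suc (Suc (Suc k))) + smult (2 * (real (Suc k) + 1) - 2 * l) (q * D (Suc (Suc k)))
      + smult ((real (Suc k) + 1) * (real (Suc k) - 2 * l)) (D (Suc k))) t = poly 0 t"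
      using *[of t] unfolding poly_add poly_mult poly_smult poly_0 poly_1 of_nat_Suc
        a_def[symmetric] b_def[symmetric] c_def[symmetric]
      by (simp add: algebra_simps)
  qed
  then show ?case by (simp add: D_def)
qed

text \<open>Legendre's differential equation and its derivatives, which are the equations of the
  Gegenbauer polynomials.\<close>
lemma legendre_ode:
  defines "y \<equiv> \<lambda>l j t. poly ((pderiv ^^ j) (legendre_poly l)) t"
  shows "(t\<^sup>2 - 1) * y l (j + 2) t + 2 * (real j + 1) * t * y l (j + 1) t
    = (real l * (real l + 1) - real j * (real j + 1)) * y l j t"
proof -
  define c :: real where "c = 1 / (2 ^ l * fact l)"
  define D where "D = (\<lambda>i. poly ((pderiv ^^ i) ([:-1, 0, 1:: real:] ^ l)) t)"
  have y: "y l i t = c * D (i + l)" for i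
    unfolding y_def legendre_poly_def c_def D_def poly_pderiv_funpow_smult by (simp add: funpow_add)
  have *: "[:-1, 0, 1:] * pderiv ([:-1, 0, 1:: real:] ^ l)
      = smult (2 * real l) ([:0, 1:] * ([:-1, 0, 1:] ^ l))"
  proof (cases l)
    case (Suc m)
    have "p * pderiv (p ^ Suc m) = smult (2 * real (Suc m)) (q * p ^ Suc m)"
      if "pderiv p = smult 2 q" for p q :: "real poly"
      by (simp only: pderiv_power_Suc that) (simp add: ac_simps)
    from this[of "[:-1, 0, 1:]" "[:0, 1:]"] show ?thesis
      unfolding Suc by (simp only: pderiv_pCons) simp
  qed simp
  have "poly ([:-1, 0, 1:] * (pderiv ^^ (j + l + 2)) ([:-1, 0, 1:: real:] ^ l)
      + smult (2 * (real (j + l) + 1) - 2 * real l) ([:0, 1:] * (pderiv ^^ (j + l + 1)) ([:-1, 0, 1:: real:] ^ l))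
      + smult ((real (j + l) + 1) * (real (j + l) - 2 * real l)) ((pderiv ^^ (j + l)) ([:-1, 0, 1:: real:] ^ l))) t = 0"
    by (subst pderiv_funpow_rodrigues[OF _ _ *]) (simp_all add: pderiv_pCons one_pCons)
  then have "(t\<^sup>2 - 1) * D (j + l + 2) + (2 * (real j + 1)) * (t * D (j + l + 1))
      + ((real j + real l + 1) * (real j - real l)) * D (j + l) = 0"
    unfolding D_def poly_add poly_mult poly_smult
    by (simp add: power2_eq_square left_diff_distrib right_diff_distrib distrib_left distrib_right)
  then have "c * ((t\<^sup>2 - 1) * D (j + l + 2) + (2 * (real j + 1)) * (t * D (j + l + 1))
      + ((real j + real l + 1) * (real j - real l)) * D (j + l)) = 0" by simp
  moreover have "y l (j + 2) t = c * D (j + l + 2)" "y l (j + 1) t = c * D (j + l + 1)"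
    by (simp_all add: y algebra_simps)
  ultimately show ?thesis unfolding y[of j] by (simp only:) (simp add: algebra_simps)
qed

text \<open>Sonin's argument: by the differential equation, \<open>\<mu> * y ^ 2 + (1 - s ^ 2) * y' ^ 2\<close> is
  nondecreasing on \<open>[0, 1]\<close>, and at 1 its second summand vanishes.\<close>
lemma sonin_bound:
  fixes y :: "real poly" and c \<mu> t :: real
  assumes ode: "\<And>s. (s\<^sup>2 - 1) * poly (pderiv (pderiv y)) s + 2 * c * s * poly (pderiv y) s = \<mu> * poly y s"
    and c: "c \<ge> 1 / 2" and \<mu>: "\<mu> > 0" and t: "0 \<le> t" "t \<le> 1"
  shows "\<bar>poly y t\<bar> \<le> \<bar>poly y 1\<bar>"
proof -
  define f where "f = smult \<mu> (y * y) + [:1, 0, -1:] * (pderiv y * pderiv y)"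
  have f': "poly (pderiv f) s = (4 * c - 2) * s * (poly (pderiv y) s)\<^sup>2" for s
  proof -
    have "poly (pderiv f) s = 2 * poly (pderiv y) s * (\<mu> * poly y s - s * poly (pderiv y) s
            - (s\<^sup>2 - 1) * poly (pderiv (pderiv y)) s)"
      unfolding f_def by (simp add: pderiv_add pderiv_smult pderiv_mult pderiv_pCons
        pderiv_minus algebra_simps power2_eq_square)
    also have "\<mu> * poly y s - s * poly (pderiv y) s - (s\<^sup>2 - 1) * poly (pderiv (pderiv y)) s
        = (2 * c - 1) * s * poly (pderiv y) s"
      using ode[of s] by (simp add: algebra_simps)
    finally show ?thesis by (simp add: power2_eq_square algebra_simps)
  qed
  have "poly f t \<le> poly f 1"
  proof (rule DERIV_nonneg_imp_nondecreasing[OF t(2)])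
    fix s assume "t \<le> s" "s \<le> 1"
    then have "(4 * c - 2) * s * (poly (pderiv y) s)\<^sup>2 \<ge> 0" using c t by simp
    then show "\<exists>d. (poly f has_real_derivative d) (at s) \<and> d \<ge> 0"
      using poly_DERIV[of f s] f'[of s] by metis
  qed
  moreover have "0 \<le> (1 - t\<^sup>2) * (poly (pderiv y) t)\<^sup>2"
    using t by (simp add: power_le_one)
  ultimately have "\<mu> * (poly y t)\<^sup>2 \<le> \<mu> * (poly y 1)\<^sup>2"
    unfolding f_def by (simp add: power2_eq_square algebra_simps)
  then show ?thesis using \<mu> by (simp add: abs_le_square_iff)
qed

lemma degree_pderiv_funpow: "degree ((pderiv ^^ n) (p :: real poly)) = degree p - n"
  by (induction n) (simp_all add: degree_pderiv)

text \<open>For \<open>j < l\<close> Sonin's bound applies; otherwise the derivative is constant.\<close>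
lemma legendre_pderiv_bound:
  assumes "0 \<le> t" "t \<le> 1"
  shows "\<bar>poly ((pderiv ^^ j) (legendre_poly l)) t\<bar> \<le> \<bar>poly ((pderiv ^^ j) (legendre_poly l)) 1\<bar>"
proof (cases "j < l")
  case True
  let ?y = "(pderiv ^^ j) (legendre_poly l)"
  show ?thesis
  proof (rule sonin_bound[OF _ _ _ assms])
    show "(s\<^sup>2 - 1) * poly (pderiv (pderiv ?y)) s + 2 * (real j + 1) * s * poly (pderiv ?y) s
      = (real l * (real l + 1) - real j * (real j + 1)) * poly ?y s" for s
      using legendre_ode[of s j l] by (simp add: numeral_2_eq_2)
    have "real j * (real j + 1) < real l * (real l + 1)"
      using True by (intro mult_strict_mono) auto
    then show "0 < real l * (real l + 1) - real j * (real j + 1)" by simp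
  qed simp
next
  case False
  have "degree ([:-1, 0, 1:: real:] ^ l) = 2 * l" by (simp add: degree_power_eq)
  then have "degree ((pderiv ^^ j) (legendre_poly l)) = 0"
    unfolding legendre_poly_def poly_pderiv_funpow_smult using False
    by (simp add: degree_pderiv_funpow)
  then obtain a where "(pderiv ^^ j) (legendre_poly l) = [:a:]" by (metis degree_eq_zeroE)
  then show ?thesis by simp
qed

lemma legendre_bound: "0 \<le> t \<Longrightarrow> t \<le> 1 \<Longrightarrow> \<bar>poly (legendre_poly l) t\<bar> \<le> 1"
  using legendre_pderiv_bound[of t 0 l] by (simp add: legendre_at_1)

text \<open>Taylor's formula of order one at 1.  Legendre's equation at 1 gives
  \<open>P' = l * (l + 1) / 2\<close> and \<open>P'' = (l - 1) * l * (l + 1) * (l + 2) / 8\<close> there, and the latter value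
  bounds \<open>P''\<close> on \<open>[0, 1]\<close>.\<close>
lemma legendre_taylor:
  fixes l :: nat and t :: real
  assumes t: "0 \<le> t" "t \<le> 1"
  defines "\<Lambda> \<equiv> real l * (real l + 1) / 2"
  shows "\<bar>1 - poly (legendre_poly l) t - \<Lambda> * (1 - t)\<bar> \<le> real l ^ 4 / 2 * (1 - t)\<^sup>2"
proof (cases "t = 1")
  case True
  then show ?thesis by (simp add: legendre_at_1)
next
  case False
  then have t1: "t < 1" using t by simp
  let ?P = "legendre_poly l"
  have "2 * poly (pderiv ?P) 1 = real l * (real l + 1)"
    using legendre_ode[of 1 0 l] by (simp add: legendre_at_1)
  then have d1: "poly (pderiv ?P) 1 = \<Lambda>" by (simp add: \<Lambda>_def)
  have d2: "poly (pderiv (pderiv ?P)) 1 = (real l * (real l + 1) - 2) * \<Lambda> / 4"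
    using legendre_ode[of 1 1 l] by (simp add: d1)
  have l2: "real l \<le> real l ^ 2" by (cases l) (auto simp: power2_eq_square)
  have l01: "0 \<le> \<Lambda>" "\<Lambda> \<le> real l ^ 2"
    using l2 by (auto simp: \<Lambda>_def power2_eq_square algebra_simps)
  have M: "\<bar>poly (pderiv (pderiv ?P)) 1\<bar> \<le> real l ^ 4 / 2"
  proof (cases "l = 0")
    case False
    then have "real l \<ge> 1" by simp
    then have "real l * (real l + 1) \<ge> 1 * (1 + 1)" by (intro mult_mono) auto
    then have "0 \<le> real l * (real l + 1) - 2" by simp
    moreover have "real l * (real l + 1) - 2 \<le> 2 * real l ^ 2"
      using l2 by (simp add: power2_eq_square algebra_simps)
    ultimately have "0 \<le> (real l * (real l + 1) - 2) * \<Lambda>"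
       "(real l * (real l + 1) - 2) * \<Lambda> \<le> 2 * real l ^ 2 * real l ^ 2"
      using l01 by (auto intro: mult_mono)
    moreover have "2 * real l ^ 2 * real l ^ 2 = 2 * real l ^ 4" by (simp add: power2_eq_square power4_eq_xxxx)
    ultimately show ?thesis unfolding d2 by (simp only: abs_le_iff) linarith
  next
    case True
    then have "\<Lambda> = 0" by (simp add: \<Lambda>_def)
    then show ?thesis unfolding d2 by simp
  qed
  obtain x where x: "t < x" "x < 1" "poly ?P 1 - poly ?P t = (1 - t) * poly (pderiv ?P) x"
    using poly_MVT[OF t1, of ?P] by blast
  obtain z where z: "x < z" "z < 1"
    "poly (pderiv ?P) 1 - poly (pderiv ?P) x = (1 - x) * poly (pderiv (pderiv ?P)) z"
    using poly_MVT[OF x(2), of "pderiv ?P"] by blast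
  have "\<bar>poly (pderiv (pderiv ?P)) z\<bar> \<le> real l ^ 4 / 2"
    using legendre_pderiv_bound[of z 2 l] M x z t by (simp add: numeral_2_eq_2)
  moreover have "1 - poly ?P t - \<Lambda> * (1 - t) = - ((1 - t) * (1 - x) * poly (pderiv (pderiv ?P)) z)"
    using x(3) z(3) unfolding d1 legendre_at_1 by algebra
  ultimately have "\<bar>1 - poly ?P t - \<Lambda> * (1 - t)\<bar> \<le> (1 - t) * (1 - t) * (real l ^ 4 / 2)"
    using x z t by (simp only: abs_minus_cancel abs_mult) (intro mult_mono, auto)
  then show ?thesis by (simp add: power2_eq_square mult.commute)
qed

text \<open>The contribution of the multipole \<open>l\<close>, up to the factor \<open>A l * (2 * l + 1) / (4 * pi)\<close>, to the
  variance of \<open>T a + T b - 2 * T c\<close>.\<close>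
definition legendre_increment :: "nat \<Rightarrow> real^3 \<Rightarrow> real^3 \<Rightarrow> real^3 \<Rightarrow> real"
  where "legendre_increment l a b c = 4 * (1 - poly (legendre_poly l) (a \<bullet> c))
    + 4 * (1 - poly (legendre_poly l) (b \<bullet> c)) - 2 * (1 - poly (legendre_poly l) (a \<bullet> b))"

text \<open>On the unit sphere \<open>1 - x \<bullet> y\<close> is half the squared chord.  By the parallelogram identity the
  first-order Taylor terms add up to a multiple of \<open>norm (a + b - 2 c) ^ 2\<close>, which is as small as the
  remainders.  The bound \<open>\<delta> \<le> 1 / 2\<close> keeps all inner products in \<open>[0, 1]\<close>, where the estimates for
  Legendre polynomials hold.\<close>
lemma legendre_increment_le:
  assumes S: "a \<in> S2" "b \<in> S2" "c \<in> S2"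
    and \<delta>: "0 \<le> \<delta>" "\<delta> \<le> 1 / 2"
    and close: "norm (a - c) \<le> \<delta>" "norm (b - c) \<le> \<delta>" "norm (a + b - 2 *\<^sub>R c) \<le> \<delta>\<^sup>2"
  shows "legendre_increment l a b c \<le> 16" "legendre_increment l a b c \<le> 6 * (real l * \<delta>) ^ 4"
proof -
  have n: "norm a = 1" "norm b = 1" "norm c = 1" using S by auto
  have dot: "1 - x \<bullet> y = (norm (x - y))\<^sup>2 / 2" if "norm x = 1" "norm y = 1" for x y :: "real^3"
    using that by (simp add: power2_norm_eq_inner inner_simps inner_commute norm_eq_1)
  have ab: "norm (a - b) \<le> 2 * \<delta>"
    using norm_triangle_ineq4[of "a - c" "b - c"] close by simp
  define s t u where "s = 1 - a \<bullet> c" and "t = 1 - b \<bullet> c" and "u = 1 - a \<bullet> b"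
  have s: "0 \<le> s" "s \<le> \<delta>\<^sup>2 / 2" unfolding s_def dot[OF n(1,3)]
    using power_mono[OF close(1), of 2] by simp_all
  have t: "0 \<le> t" "t \<le> \<delta>\<^sup>2 / 2" unfolding t_def dot[OF n(2,3)]
    using power_mono[OF close(2), of 2] by simp_all
  have u: "0 \<le> u" "u \<le> 2 * \<delta>\<^sup>2" unfolding u_def dot[OF n(1,2)]
    using power_mono[OF ab, of 2] by (simp_all add: power_mult_distrib)
  have "\<delta>\<^sup>2 \<le> (1 / 2)\<^sup>2" using \<delta> by (intro power_mono) auto
  then have \<delta>2: "\<delta>\<^sup>2 \<le> 1 / 4" by (simp add: power2_eq_square)
  then have le1: "s \<le> 1" "t \<le> 1" "u \<le> 1" using s t u by auto
  define Q where "Q x = 1 - poly (legendre_poly l) (1 - x)" for x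
  have Q: "Q x \<ge> 0" "Q x \<le> 2" "\<bar>Q x - real l * (real l + 1) / 2 * x\<bar> \<le> real l ^ 4 / 2 * x\<^sup>2"
    if "0 \<le> x" "x \<le> 1" for x
    using legendre_bound[of "1 - x" l] legendre_taylor[of "1 - x" l] that by (auto simp: Q_def)
  have V: "legendre_increment l a b c = 4 * Q s + 4 * Q t - 2 * Q u"
    by (simp add: legendre_increment_def Q_def s_def t_def u_def)
  show "legendre_increment l a b c \<le> 16"
    using Q(2)[OF s(1) le1(1)] Q(2)[OF t(1) le1(2)] Q(1)[OF u(1) le1(3)] unfolding V by linarith
  define L where "L = real l * (real l + 1) / 2"
  have L: "0 \<le> L" "L \<le> real l ^ 4"
  proof -
    show "0 \<le> L" by (simp add: L_def)
    have "real l \<le> real l ^ 2" by (cases l) (auto simp: power2_eq_square)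
    moreover have "real l ^ 2 \<le> real l ^ 4" by (cases "l = 0") (auto intro: power_increasing)
    ultimately show "L \<le> real l ^ 4" by (simp add: L_def power2_eq_square algebra_simps)
  qed
  have parallelogram: "4 * s + 4 * t - 2 * u = (norm (a + b - 2 *\<^sub>R c))\<^sup>2"
    using n unfolding s_def t_def u_def
    by (simp add: power2_norm_eq_inner inner_simps inner_commute norm_eq_1)
  have "(norm (a + b - 2 *\<^sub>R c))\<^sup>2 \<le> (\<delta>\<^sup>2)\<^sup>2" using close(3) by (intro power_mono) auto
  then have "L * (4 * s + 4 * t - 2 * u) \<le> real l ^ 4 * \<delta> ^ 4"
    unfolding parallelogram using L by (intro mult_mono) (auto simp: power_mult[symmetric])
  then have 1: "4 * (L * s) + 4 * (L * t) - 2 * (L * u) \<le> real l ^ 4 * \<delta> ^ 4"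
    by (simp add: algebra_simps)
  have sq: "real l ^ 4 / 2 * x\<^sup>2 \<le> real l ^ 4 * \<delta> ^ 4 * (k\<^sup>2 / 2)"
    if "0 \<le> x" "x \<le> k * \<delta>\<^sup>2" for x k
  proof -
    have "x\<^sup>2 \<le> (k * \<delta>\<^sup>2)\<^sup>2" using that by (intro power_mono) auto
    then have "real l ^ 4 / 2 * x\<^sup>2 \<le> real l ^ 4 / 2 * (k * \<delta>\<^sup>2)\<^sup>2" by (intro mult_left_mono) auto
    then show ?thesis by (simp add: power_mult_distrib power_mult[symmetric] mult_ac)
  qed
  have e: "(1 / 2)\<^sup>2 / 2 = (1 / 8 :: real)" "2\<^sup>2 / 2 = (2 :: real)"
    by (simp_all add: power2_eq_square)
  have "Q s \<le> L * s + real l ^ 4 * \<delta> ^ 4 * (1 / 8)"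
    using Q(3)[OF s(1) le1(1), folded L_def] sq[of s "1/2"] s unfolding e by linarith
  moreover have "Q t \<le> L * t + real l ^ 4 * \<delta> ^ 4 * (1 / 8)"
    using Q(3)[OF t(1) le1(2), folded L_def] sq[of t "1/2"] t unfolding e by linarith
  moreover have "Q u \<ge> L * u - real l ^ 4 * \<delta> ^ 4 * 2"
    using Q(3)[OF u(1) le1(3), folded L_def] sq[of u 2] u unfolding e by linarith
  ultimately show "legendre_increment l a b c \<le> 6 * (real l * \<delta>) ^ 4"
    using 1 unfolding V power_mult_distrib by linarith
qed

section \<open>Normal random variables\<close>

lemma normal_rv_square_integrable:
  assumes "prob_space M" "normal_rv M X"
  shows "integrable M X" "integrable M (\<lambda>\<omega>. (X \<omega>)\<^sup>2)"
proof -
  interpret prob_space M by fact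
  have [measurable]: "X \<in> borel_measurable M" using assms by (simp add: normal_rv_def)
  obtain \<mu> where "(AE \<omega> in M. X \<omega> = \<mu>) \<or>
         (\<exists>\<sigma>>0. distributed M lborel X (\<lambda>t. ennreal (normal_density \<mu> \<sigma> t)))"
    using assms(2) unfolding normal_rv_def by blast
  then have "integrable M X \<and> integrable M (\<lambda>\<omega>. (X \<omega>)\<^sup>2)"
  proof
    assume ae: "AE \<omega> in M. X \<omega> = \<mu>"
    have "integrable M X \<longleftrightarrow> integrable M (\<lambda>_. \<mu>)" using ae by (intro integrable_cong_AE) auto
    moreover have "integrable M (\<lambda>\<omega>. (X \<omega>)\<^sup>2) \<longleftrightarrow> integrable M (\<lambda>_. \<mu>\<^sup>2)"
      using ae by (intro integrable_cong_AE) auto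
    ultimately show ?thesis by simp
  next
    assume "\<exists>\<sigma>>0. distributed M lborel X (\<lambda>t. ennreal (normal_density \<mu> \<sigma> t))"
    then obtain \<sigma> where \<sigma>: "\<sigma> > 0" and d: "distributed M lborel X (\<lambda>t. ennreal (normal_density \<mu> \<sigma> t))"
      by blast
    have int: "integrable M (\<lambda>\<omega>. (X \<omega> - \<mu>) ^ k)" for k
      using distributed_integrable[OF d, of "\<lambda>x. (x - \<mu>) ^ k"] integrable_normal_moment[OF \<sigma>, of \<mu> k]
      by (simp add: normal_density_nonneg)
    have "integrable M (\<lambda>\<omega>. (X \<omega> - \<mu>) ^ 1 + \<mu>)"
      by (intro Bochner_Integration.integrable_add int) simp
    moreover have "integrable M (\<lambda>\<omega>. (X \<omega> - \<mu>) ^ 2 + 2 * \<mu> * (X \<omega> - \<mu>) ^ 1 + \<mu>\<^sup>2)"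
      by (intro Bochner_Integration.integrable_add integrable_mult_right int) simp
    moreover have "(\<lambda>\<omega>. (X \<omega> - \<mu>) ^ 2 + 2 * \<mu> * (X \<omega> - \<mu>) ^ 1 + \<mu>\<^sup>2) = (\<lambda>\<omega>. (X \<omega>)\<^sup>2)"
      by (simp add: fun_eq_iff power2_eq_square algebra_simps)
    ultimately show ?thesis by simp
  qed
  then show "integrable M X" "integrable M (\<lambda>\<omega>. (X \<omega>)\<^sup>2)" by blast+
qed

text \<open>The formula also holds for the degenerate variable 0, where both sides are \<open>0 ^ k\<close>.\<close>
lemma centered_normal_rv_even_moment:
  assumes "prob_space M" "normal_rv M X" and mean: "(LINT \<omega>|M. X \<omega>) = 0"
  shows "integrable M (\<lambda>\<omega>. X \<omega> ^ (2 * k))"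
    and "(LINT \<omega>|M. X \<omega> ^ (2 * k)) = fact (2 * k) / (2 ^ k * fact k) * (LINT \<omega>|M. (X \<omega>)\<^sup>2) ^ k"
proof -
  interpret prob_space M by fact
  have [measurable]: "X \<in> borel_measurable M" using assms by (simp add: normal_rv_def)
  obtain \<mu> where "(AE \<omega> in M. X \<omega> = \<mu>) \<or>
         (\<exists>\<sigma>>0. distributed M lborel X (\<lambda>t. ennreal (normal_density \<mu> \<sigma> t)))"
    using assms(2) unfolding normal_rv_def by blast
  then have "integrable M (\<lambda>\<omega>. X \<omega> ^ (2 * k)) \<and>
    (LINT \<omega>|M. X \<omega> ^ (2 * k)) = fact (2 * k) / (2 ^ k * fact k) * (LINT \<omega>|M. (X \<omega>)\<^sup>2) ^ k"
  proof
    assume ae: "AE \<omega> in M. X \<omega> = \<mu>"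
    then have "(LINT \<omega>|M. X \<omega>) = (LINT \<omega>|M. \<mu>)" by (intro integral_cong_AE) auto
    then have "\<mu> = 0" using mean by (simp add: prob_space)
    then have ae0: "AE \<omega> in M. X \<omega> ^ j = 0 ^ j" for j using ae by auto
    have "integrable M (\<lambda>\<omega>. X \<omega> ^ j) \<longleftrightarrow> integrable M (\<lambda>_. 0 ^ j :: real)" for j
      using ae0[of j] by (intro integrable_cong_AE) auto
    moreover have "(LINT \<omega>|M. X \<omega> ^ j) = 0 ^ j" for j
    proof -
      have "(LINT \<omega>|M. X \<omega> ^ j) = (LINT \<omega>|M. 0 ^ j)" using ae0[of j] by (intro integral_cong_AE) auto
      then show ?thesis by (simp add: prob_space)
    qed
    ultimately show ?thesis by (cases "k = 0") (simp_all add: prob_space zero_power)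
  next
    assume "\<exists>\<sigma>>0. distributed M lborel X (\<lambda>t. ennreal (normal_density \<mu> \<sigma> t))"
    then obtain \<sigma> where \<sigma>: "\<sigma> > 0" and d: "distributed M lborel X (\<lambda>t. ennreal (normal_density \<mu> \<sigma> t))"
      by blast
    have "(LINT \<omega>|M. X \<omega>) = \<mu>"
      using distributed_integral[OF d, of "\<lambda>x. x"] integral_normal_moment_nz_1[OF \<sigma>, of \<mu>]
      by (simp add: normal_density_nonneg)
    then have \<mu>: "\<mu> = 0" using mean by simp
    have int: "integrable M (\<lambda>\<omega>. X \<omega> ^ j)" for j
      using distributed_integrable[OF d, of "\<lambda>x. x ^ j"] integrable_normal_moment[OF \<sigma>, of \<mu> j] \<mu>
      by (simp add: normal_density_nonneg)
    have E: "(LINT \<omega>|M. X \<omega> ^ (2 * j)) = fact (2 * j) / ((2 / \<sigma>\<^sup>2) ^ j * fact j)" for j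
      using distributed_integral[OF d, of "\<lambda>x. x ^ (2 * j)"] integral_normal_moment_even[OF \<sigma>, of \<mu> j] \<mu>
      by (simp add: normal_density_nonneg)
    have "(LINT \<omega>|M. (X \<omega>)\<^sup>2) = \<sigma>\<^sup>2" using E[of 1] by simp
    then show ?thesis using int E[of k] \<sigma> by (simp add: power_divide)
  qed
  then show "integrable M (\<lambda>\<omega>. X \<omega> ^ (2 * k))"
    "(LINT \<omega>|M. X \<omega> ^ (2 * k)) = fact (2 * k) / (2 ^ k * fact k) * (LINT \<omega>|M. (X \<omega>)\<^sup>2) ^ k"
    by blast+
qed

text \<open>Markov's inequality for the moment of order \<open>2 * k\<close>.\<close>
lemma centered_normal_rv_tail:
  assumes "prob_space M" "normal_rv M X" and mean: "(LINT \<omega>|M. X \<omega>) = 0"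
    and v: "(LINT \<omega>|M. (X \<omega>)\<^sup>2) \<le> v" and t: "t > 0"
  shows "measure M {\<omega> \<in> space M. \<bar>X \<omega>\<bar> \<ge> t} \<le> fact (2 * k) / (2 ^ k * fact k) * (v / t\<^sup>2) ^ k"
proof -
  interpret prob_space M by fact
  have [measurable]: "X \<in> borel_measurable M" using assms by (simp add: normal_rv_def)
  note moment = centered_normal_rv_even_moment[OF assms(1-3), of k]
  have "measure M {\<omega> \<in> space M. \<bar>X \<omega>\<bar> \<ge> t} \<le> measure M {\<omega> \<in> space M. X \<omega> ^ (2 * k) \<ge> t ^ (2 * k)}"
  proof (rule finite_measure_mono)
    show "{\<omega> \<in> space M. \<bar>X \<omega>\<bar> \<ge> t} \<subseteq> {\<omega> \<in> space M. X \<omega> ^ (2 * k) \<ge> t ^ (2 * k)}"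
    proof safe
      fix \<omega> assume "t \<le> \<bar>X \<omega>\<bar>"
      then have "t ^ (2 * k) \<le> \<bar>X \<omega>\<bar> ^ (2 * k)" using t by (intro power_mono) auto
      then show "t ^ (2 * k) \<le> X \<omega> ^ (2 * k)" by (simp add: power_even_abs)
    qed
  qed measurable
  also have "\<dots> \<le> (LINT \<omega>|M. X \<omega> ^ (2 * k)) / t ^ (2 * k)"
    using t by (intro integral_Markov_inequality_measure[where A = "{}"] moment(1)) auto
  also have "\<dots> = fact (2 * k) / (2 ^ k * fact k) * ((LINT \<omega>|M. (X \<omega>)\<^sup>2) / t\<^sup>2) ^ k"
    unfolding moment(2) by (simp add: power_divide power_mult)
  also have "\<dots> \<le> fact (2 * k) / (2 ^ k * fact k) * (v / t\<^sup>2) ^ k"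
    using v t by (intro mult_left_mono power_mono divide_right_mono divide_nonneg_nonneg) auto
  finally show ?thesis .
qed

text \<open>A union bound and the Borel--Cantelli lemma.  The ratio of the variance bound to the squared
  threshold is \<open>V * r ^ n\<close> with \<open>r = (a / b) ^ 2 < 1\<close>; the moment of order \<open>2 * k\<close> turns it into its
  \<open>k\<close>-th power, and \<open>k\<close> is chosen so large that \<open>(r ^ k) ^ n\<close> beats the number of variables.\<close>
lemma gaussian_array_eventually_small:
  fixes X :: "nat \<Rightarrow> 'i \<Rightarrow> 'w \<Rightarrow> real" and a b V :: real
  assumes "prob_space M"
    and I: "\<And>n. finite (I n)" "\<And>n. card (I n) \<le> B * 8 ^ n"
    and normal: "\<And>n i. i \<in> I n \<Longrightarrow> normal_rv M (X n i)"
    and mean: "\<And>n i. i \<in> I n \<Longrightarrow> (LINT \<omega>|M. X n i \<omega>) = 0"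
    and var: "\<And>n i. i \<in> I n \<Longrightarrow> (LINT \<omega>|M. (X n i \<omega>)\<^sup>2) \<le> V * (a ^ n)\<^sup>2"
    and V: "V \<ge> 0" and ab: "0 < a" "a < b"
  shows "AE \<omega> in M. eventually (\<lambda>n. \<forall>i\<in>I n. \<bar>X n i \<omega>\<bar> \<le> b ^ n) sequentially"
proof -
  interpret prob_space M by fact
  define r where "r = (a / b)\<^sup>2"
  have r: "0 < r" "r < 1" using ab by (simp_all add: r_def power_strict_decreasing[of 0] abs_square_less_1)
  \<comment> \<open>\<open>1 / 16\<close> leaves the summable factor \<open>(1 / 2) ^ n\<close> after multiplication by \<open>8 ^ n\<close>.\<close>
  obtain k where k: "r ^ k < 1 / 16" using real_arch_pow_inv[of "1 / 16" r] r by auto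
  define c where "c = fact (2 * k) / (2 ^ k * fact k) * V ^ k"
  have c: "c \<ge> 0" using V by (simp add: c_def)
  define E where "E n = (\<Union>i\<in>I n. {\<omega> \<in> space M. \<bar>X n i \<omega>\<bar> \<ge> b ^ n})" for n
  have X[measurable]: "X n i \<in> borel_measurable M" if "i \<in> I n" for n i
    using normal[OF that] by (simp add: normal_rv_def)
  have sets: "{\<omega> \<in> space M. \<bar>X n i \<omega>\<bar> \<ge> b ^ n} \<in> sets M" if "i \<in> I n" for n i
    using X[OF that] by measurable
  then have E[measurable]: "E n \<in> sets M" for n unfolding E_def using I by blast
  have bound: "measure M (E n) \<le> real B * c * (1 / 2) ^ n" for n
  proof -
    have b: "b ^ n > 0" using ab by simp
    have "measure M (E n) \<le> (\<Sum>i\<in>I n. measure M {\<omega> \<in> space M. \<bar>X n i \<omega>\<bar> \<ge> b ^ n})"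
      unfolding E_def using sets I by (intro finite_measure_subadditive_finite) auto
    also have "\<dots> \<le> (\<Sum>i\<in>I n. fact (2 * k) / (2 ^ k * fact k) * (V * (a ^ n)\<^sup>2 / (b ^ n)\<^sup>2) ^ k)"
      using b by (intro sum_mono centered_normal_rv_tail assms(1) normal mean var)
    also have "\<dots> = real (card (I n)) * (c * (r ^ k) ^ n)"
      by (simp add: c_def r_def power_mult_distrib power_divide power_mult[symmetric] mult_ac)
    also have "\<dots> \<le> (real B * 8 ^ n) * (c * (1 / 16) ^ n)"
    proof (intro mult_mono)
      have "real (card (I n)) \<le> real (B * 8 ^ n)" using I(2) by (rule of_nat_mono)
      then show "real (card (I n)) \<le> real B * 8 ^ n" by simp
      show "(r ^ k) ^ n \<le> (1 / 16) ^ n" using k r by (intro power_mono) auto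
    qed (use c r in auto)
    also have "\<dots> = real B * c * (8 * (1 / 16)) ^ n" unfolding power_mult_distrib by simp
    finally show ?thesis by simp
  qed
  have "summable (\<lambda>n. measure M (E n))"
    by (rule summable_comparison_test[where g = "\<lambda>n. real B * c * (1 / 2) ^ n"])
      (use bound in \<open>auto intro!: exI[of _ 0]\<close>)
  then have "AE \<omega> in M. eventually (\<lambda>n. \<omega> \<in> space M - E n) sequentially"
    by (intro borel_cantelli_AE1) (simp_all add: less_top[symmetric])
  then show ?thesis
  proof eventually_elim
    case (elim \<omega>)
    then show ?case
      by eventually_elim (auto simp: E_def not_le intro: less_imp_le)
  qed
qed

lemma square_integrable_product:
  fixes X Y :: "'w \<Rightarrow> real"
  assumes [measurable]: "X \<in> borel_measurable M" "Y \<in> borel_measurable M"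
    and "integrable M (\<lambda>\<omega>. (X \<omega>)\<^sup>2)" "integrable M (\<lambda>\<omega>. (Y \<omega>)\<^sup>2)"
  shows "integrable M (\<lambda>\<omega>. X \<omega> * Y \<omega>)"
proof (rule Bochner_Integration.integrable_bound)
  show "integrable M (\<lambda>\<omega>. (X \<omega>)\<^sup>2 + (Y \<omega>)\<^sup>2)" using assms by simp
  have "\<bar>x * y\<bar> \<le> x\<^sup>2 + y\<^sup>2" for x y :: real
  proof -
    have "2 * (\<bar>x\<bar> * \<bar>y\<bar>) \<le> x\<^sup>2 + y\<^sup>2" using sum_squares_bound[of "\<bar>x\<bar>" "\<bar>y\<bar>"] by simp
    moreover have "0 \<le> \<bar>x\<bar> * \<bar>y\<bar>" by simp
    ultimately show ?thesis unfolding abs_mult by linarith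
  qed
  then show "AE \<omega> in M. norm (X \<omega> * Y \<omega>) \<le> norm ((X \<omega>)\<^sup>2 + (Y \<omega>)\<^sup>2)" by simp
qed measurable

section \<open>Second-order increments of an isotropic field\<close>

locale isotropic_spectral_field = prob_space M for M :: "'w measure" +
  fixes T :: "'w sphere_field" and A :: "nat \<Rightarrow> real"
  assumes isotropic: "isotropic_gaussian_field M T"
    and spectrum: "angular_power_spectrum M T A"
begin

definition increment :: "real^3 \<Rightarrow> real^3 \<Rightarrow> real^3 \<Rightarrow> 'w \<Rightarrow> real"
  where "increment a b c \<omega> = T \<omega> a + T \<omega> b - 2 * T \<omega> c"

text \<open>Rotations act transitively on the sphere.\<close>
lemma mean_constant:
  assumes "x \<in> S2" "y \<in> S2"
  shows "field_mean M T x = field_mean M T y"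
proof -
  have "2 \<le> CARD(3)" by simp
  moreover have "norm x = norm y" using assms by simp
  ultimately obtain g where g: "orthogonal_transformation g" "det (matrix g) = 1" "g x = y"
    using rotation_exists[of x y] by metis
  then have "rotation_matrix (matrix g)"
    by (simp add: rotation_matrix_def orthogonal_transformation_matrix)
  moreover have "matrix g *v x = y"
    using g by (simp add: matrix_works orthogonal_transformation_linear)
  ultimately show ?thesis
    using isotropic assms(1) unfolding isotropic_gaussian_field_def by metis
qed

lemma normal_T:
  assumes "x \<in> S2"
  shows "normal_rv M (\<lambda>\<omega>. T \<omega> x)"
proof -
  have "multivariate_gaussian M 1 (\<lambda>i \<omega>. T \<omega> x)"
    using isotropic assms unfolding isotropic_gaussian_field_def gaussian_field_def by force
  from this[unfolded multivariate_gaussian_def, THEN spec, of "\<lambda>_. 1"] show ?thesis by simp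
qed

lemma normal_increment:
  assumes "a \<in> S2" "b \<in> S2" "c \<in> S2"
  shows "normal_rv M (increment a b c)"
proof -
  define x :: "nat \<Rightarrow> real^3" where "x i = (if i = 0 then a else if i = 1 then b else c)" for i
  have "multivariate_gaussian M 3 (\<lambda>i \<omega>. T \<omega> (x i))"
    using isotropic assms unfolding isotropic_gaussian_field_def gaussian_field_def
    by (simp add: x_def)
  from this[unfolded multivariate_gaussian_def, THEN spec, of "\<lambda>i. if i = 2 then -2 else 1"]
  show ?thesis
    by (simp add: increment_def[abs_def] x_def eval_nat_numeral)
qed

lemma integrable_T:
  assumes "x \<in> S2"
  shows "integrable M (\<lambda>\<omega>. T \<omega> x)" "integrable M (\<lambda>\<omega>. (T \<omega> x)\<^sup>2)"
  using normal_rv_square_integrable[OF prob_space_axioms normal_T[OF assms]] by auto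

lemma mean_increment:
  assumes "a \<in> S2" "b \<in> S2" "c \<in> S2"
  shows "(LINT \<omega>|M. increment a b c \<omega>) = 0"
  unfolding increment_def
  using assms mean_constant[of a c] mean_constant[of b c] by (simp add: integrable_T field_mean_def)

lemma variance_increment:
  assumes "a \<in> S2" "b \<in> S2" "c \<in> S2"
  shows "(LINT \<omega>|M. (increment a b c \<omega>)\<^sup>2) = field_cov M T a a + field_cov M T b b
    + 4 * field_cov M T c c + 2 * field_cov M T a b - 4 * field_cov M T a c - 4 * field_cov M T b c"
proof -
  define m where "m = field_mean M T c"
  define Y where "Y x \<omega> = T \<omega> x - m" for x \<omega>
  have mean: "field_mean M T x = m" if "x \<in> S2" for x
    using mean_constant[OF that assms(3)] by (simp add: m_def)
  have meas: "Y x \<in> borel_measurable M" if "x \<in> S2" for x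
    using integrable_T(1)[OF that] unfolding Y_def by (intro borel_measurable_diff) auto
  have sq: "integrable M (\<lambda>\<omega>. (Y x \<omega>)\<^sup>2)" if "x \<in> S2" for x
  proof -
    have "integrable M (\<lambda>\<omega>. (T \<omega> x)\<^sup>2 - 2 * m * T \<omega> x + m\<^sup>2)"
      by (intro Bochner_Integration.integrable_add Bochner_Integration.integrable_diff
          integrable_mult_right integrable_T that) simp
    then show ?thesis by (simp add: Y_def power2_eq_square algebra_simps)
  qed
  have int: "integrable M (\<lambda>\<omega>. Y x \<omega> * Y y \<omega>)" if "x \<in> S2" "y \<in> S2" for x y
    by (intro square_integrable_product meas sq that)
  have cov: "(LINT \<omega>|M. Y x \<omega> * Y y \<omega>) = field_cov M T x y" if "x \<in> S2" "y \<in> S2" for x y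
    unfolding field_cov_def Y_def mean[OF that(1)] mean[OF that(2)] ..
  have "(LINT \<omega>|M. (increment a b c \<omega>)\<^sup>2)
    = (LINT \<omega>|M. Y a \<omega> * Y a \<omega> + Y b \<omega> * Y b \<omega> + 4 * (Y c \<omega> * Y c \<omega>) + 2 * (Y a \<omega> * Y b \<omega>)
        - 4 * (Y a \<omega> * Y c \<omega>) - 4 * (Y b \<omega> * Y c \<omega>))"
    by (intro Bochner_Integration.integral_cong refl)
      (simp add: increment_def Y_def power2_eq_square algebra_simps)
  also have "\<dots> = (LINT \<omega>|M. Y a \<omega> * Y a \<omega>) + (LINT \<omega>|M. Y b \<omega> * Y b \<omega>) + 4 * (LINT \<omega>|M. Y c \<omega> * Y c \<omega>)
      + 2 * (LINT \<omega>|M. Y a \<omega> * Y b \<omega>) - 4 * (LINT \<omega>|M. Y a \<omega> * Y c \<omega>) - 4 * (LINT \<omega>|M. Y b \<omega> * Y c \<omega>)"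
    using assms by (simp add: int)
  finally show ?thesis using assms by (simp add: cov)
qed

lemma variance_increment_sums:
  assumes "a \<in> S2" "b \<in> S2" "c \<in> S2"
  shows "(\<lambda>l. A l * ((2 * real l + 1) / (4 * pi)) * legendre_increment l a b c)
    sums (LINT \<omega>|M. (increment a b c \<omega>)\<^sup>2)"
proof -
  define w where "w l = A l * ((2 * real l + 1) / (4 * pi))" for l
  have s: "(\<lambda>l. w l * poly (legendre_poly l) (x \<bullet> y)) sums field_cov M T x y" if "x \<in> S2" "y \<in> S2" for x y
    using spectrum that unfolding angular_power_spectrum_def w_def by blast
  have one: "x \<bullet> x = 1" if "x \<in> S2" for x using that by (simp add: norm_eq_1)
  have d: "w sums field_cov M T x x" if "x \<in> S2" for x
    using s[OF that that] unfolding one[OF that] legendre_at_1 by simp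
  have "(\<lambda>l. w l + w l + 4 * w l + 2 * (w l * poly (legendre_poly l) (a \<bullet> b))
      - 4 * (w l * poly (legendre_poly l) (a \<bullet> c)) - 4 * (w l * poly (legendre_poly l) (b \<bullet> c)))
    sums (LINT \<omega>|M. (increment a b c \<omega>)\<^sup>2)"
    unfolding variance_increment[OF assms]
    by (intro sums_add sums_diff sums_mult s d assms)
  moreover have "w l + w l + 4 * w l + 2 * (w l * poly (legendre_poly l) (a \<bullet> b))
      - 4 * (w l * poly (legendre_poly l) (a \<bullet> c)) - 4 * (w l * poly (legendre_poly l) (b \<bullet> c))
      = w l * legendre_increment l a b c" for l
    unfolding legendre_increment_def by (simp add: algebra_simps)
  ultimately show ?thesis by (simp add: w_def)
qed

text \<open>For \<open>\<kappa> \<le> 2\<close> the bound \<open>min 16 (6 * z ^ 4)\<close> of the \<open>l\<close>-th contribution, where \<open>z = l * \<delta>\<close>, is at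
  most \<open>16 * z powr (2 * \<kappa>)\<close>.  This interpolation leaves the series with terms
  \<open>l powr (1 - \<alpha> + 2 * \<kappa>)\<close>, whose convergence is the condition \<open>2 * \<kappa> < \<alpha> - 2\<close>.\<close>
lemma variance_increment_le:
  fixes \<alpha> C \<kappa> :: real
  assumes decay: "\<And>l. l \<ge> 1 \<Longrightarrow> A l \<le> C * real l powr (- \<alpha>)"
    and \<kappa>: "0 < \<kappa>" "\<kappa> \<le> 2" "2 * \<kappa> < \<alpha> - 2"
  shows "\<exists>V\<ge>0. \<forall>a\<in>S2. \<forall>b\<in>S2. \<forall>c\<in>S2. \<forall>\<delta>. 0 < \<delta> \<and> \<delta> \<le> 1 / 2 \<and> norm (a - c) \<le> \<delta> \<and>
    norm (b - c) \<le> \<delta> \<and> norm (a + b - 2 *\<^sub>R c) \<le> \<delta>\<^sup>2 \<longrightarrow>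
    (LINT \<omega>|M. (increment a b c \<omega>)\<^sup>2) \<le> V * (\<delta> powr \<kappa>)\<^sup>2"
proof -
  define \<zeta> where "\<zeta> = (\<Sum>l. real l powr (1 - \<alpha> + 2 * \<kappa>))"
  have sm: "summable (\<lambda>l. real l powr (1 - \<alpha> + 2 * \<kappa>))"
    using \<kappa> by (simp add: summable_real_powr_iff)
  have A0: "A l \<ge> 0" for l using spectrum by (simp add: angular_power_spectrum_def)
  have C: "C \<ge> 0" using A0[of 1] decay[of 1] by simp
  have \<zeta>: "\<zeta> \<ge> 0" unfolding \<zeta>_def by (intro suminf_nonneg sm) simp
  show ?thesis
  proof (intro exI[of _ "16 * C * \<zeta>"] conjI ballI allI impI)
    show "16 * C * \<zeta> \<ge> 0" using C \<zeta> by simp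
    fix a b c :: "real^3" and \<delta> :: real
    assume S: "a \<in> S2" "b \<in> S2" "c \<in> S2"
    assume \<delta>: "0 < \<delta> \<and> \<delta> \<le> 1 / 2 \<and> norm (a - c) \<le> \<delta> \<and>
      norm (b - c) \<le> \<delta> \<and> norm (a + b - 2 *\<^sub>R c) \<le> \<delta>\<^sup>2"
    have inc: "legendre_increment l a b c \<le> 16" "legendre_increment l a b c \<le> 6 * (real l * \<delta>) ^ 4" for l
      using legendre_increment_le[OF S, of \<delta> l] \<delta> by auto
    have le_term: "A l * ((2 * real l + 1) / (4 * pi)) * legendre_increment l a b c
        \<le> 16 * C * (\<delta> powr \<kappa>)\<^sup>2 * real l powr (1 - \<alpha> + 2 * \<kappa>)" for l
    proof (cases "l = 0")
      case True
      have "A 0 * ((2 * real 0 + 1) / (4 * pi)) * legendre_increment 0 a b c \<le> 0"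
        using inc(2)[of 0] A0[of 0] by (intro mult_nonneg_nonpos) auto
      then show ?thesis using True by simp
    next
      case False
      then have l: "real l \<ge> 1" by simp
      define z where "z = real l * \<delta>"
      have z: "z > 0" using l \<delta> by (simp add: z_def)
      have "legendre_increment l a b c \<le> 16 * z powr (2 * \<kappa>)"
      proof (cases "z \<le> 1")
        case True
        have "z ^ 4 = z powr 4" using z by simp
        also have "\<dots> \<le> z powr (2 * \<kappa>)" using z True \<kappa> by (intro powr_mono') auto
        finally show ?thesis using inc(2)[of l] powr_ge_zero[of z "2 * \<kappa>"] unfolding z_def[symmetric] by linarith
      next
        case False
        then have "1 \<le> z powr (2 * \<kappa>)" using \<kappa> by (intro ge_one_powr_ge_zero) auto
        then show ?thesis using inc(1)[of l] by linarith
      qed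
      also have "z powr (2 * \<kappa>) = real l powr (2 * \<kappa>) * (\<delta> powr \<kappa>)\<^sup>2"
        using \<delta> by (simp add: z_def powr_mult powr_power mult.commute)
      finally have i: "legendre_increment l a b c \<le> 16 * (real l powr (2 * \<kappa>) * (\<delta> powr \<kappa>)\<^sup>2)" .
      have "(2 * real l + 1) / (4 * pi) \<le> real l"
      proof -
        have "2 * real l + 1 \<le> real l * 3" using l by simp
        also have "\<dots> \<le> real l * (4 * pi)" using pi_gt3 by (intro mult_left_mono) auto
        finally show ?thesis by (simp add: divide_le_eq)
      qed
      moreover have "A l \<le> C * real l powr - \<alpha>" using decay[of l] False by simp
      ultimately have w: "A l * ((2 * real l + 1) / (4 * pi)) \<le> C * real l powr - \<alpha> * real l"
        using A0[of l] C by (intro mult_mono) auto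
      have "A l * ((2 * real l + 1) / (4 * pi)) * legendre_increment l a b c
          \<le> A l * ((2 * real l + 1) / (4 * pi)) * (16 * (real l powr (2 * \<kappa>) * (\<delta> powr \<kappa>)\<^sup>2))"
        using A0[of l] by (intro mult_left_mono i) simp
      also have "\<dots> \<le> C * real l powr - \<alpha> * real l * (16 * (real l powr (2 * \<kappa>) * (\<delta> powr \<kappa>)\<^sup>2))"
        by (intro mult_right_mono w) simp
      also have "\<dots> = 16 * C * (\<delta> powr \<kappa>)\<^sup>2 * (real l powr - \<alpha> * real l powr 1 * real l powr (2 * \<kappa>))"
        using l by (simp add: mult_ac)
      also have "real l powr - \<alpha> * real l powr 1 * real l powr (2 * \<kappa>) = real l powr (1 - \<alpha> + 2 * \<kappa>)"
        unfolding powr_add[symmetric] by (simp add: algebra_simps)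
      finally show ?thesis .
    qed
    have "(\<lambda>l. 16 * C * (\<delta> powr \<kappa>)\<^sup>2 * real l powr (1 - \<alpha> + 2 * \<kappa>)) sums (16 * C * (\<delta> powr \<kappa>)\<^sup>2 * \<zeta>)"
      unfolding \<zeta>_def by (intro sums_mult summable_sums sm)
    from sums_le[OF le_term variance_increment_sums[OF S] this]
    show "(LINT \<omega>|M. (increment a b c \<omega>)\<^sup>2) \<le> 16 * C * \<zeta> * (\<delta> powr \<kappa>)\<^sup>2"
      by (simp add: mult_ac)
  qed
qed

end

section \<open>From second differences on dyadic grids to Hoelder continuity\<close>

definition grid :: "nat \<Rightarrow> (real^3) set"
  where "grid n = {p. \<forall>i. 2 ^ n * p $ i \<in> \<int>}"

definition grid_floor :: "nat \<Rightarrow> real^3 \<Rightarrow> real^3"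
  where "grid_floor n x = (\<chi> i. of_int \<lfloor>2 ^ n * x $ i\<rfloor> / 2 ^ n)"

definition second_diff :: "(real^3 \<Rightarrow> real) \<Rightarrow> nat \<Rightarrow> real^3 \<Rightarrow> 3 \<Rightarrow> real"
  where "second_diff f n p j = f (p + axis j (1 / 2 ^ n)) + f (p - axis j (1 / 2 ^ n)) - 2 * f p"

lemma finite_grid_bounded:
  shows "finite {p \<in> grid n. norm p \<le> 2}" (is "finite ?G")
    and "card {p \<in> grid n. norm p \<le> 2} \<le> 512 * 8 ^ n"
proof -
  let ?I = "{- (2 ^ (n + 1)) .. 2 ^ (n + 1) :: int}"
  let ?F = "Pi\<^sub>E (UNIV :: 3 set) (\<lambda>_. ?I)"
  have sub: "?G \<subseteq> (\<lambda>z. \<chi> i. of_int (z i) / 2 ^ n) ` ?F"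
  proof
    fix p assume p: "p \<in> ?G"
    define z where "z i = \<lfloor>2 ^ n * p $ i\<rfloor>" for i
    have z: "of_int (z i) = 2 ^ n * p $ i" for i
      using p by (auto simp: z_def grid_def elim: Ints_cases)
    have "\<bar>of_int (z i)\<bar> \<le> real_of_int (2 ^ (n + 1))" for i
    proof -
      have "\<bar>p $ i\<bar> \<le> 2" using p component_le_norm_cart[of p i] by simp
      then have "2 ^ n * \<bar>p $ i\<bar> \<le> 2 ^ n * 2" by (intro mult_left_mono) auto
      then show ?thesis by (simp add: z abs_mult mult.commute)
    qed
    then have "\<bar>z i\<bar> \<le> 2 ^ (n + 1)" for i
      by (metis of_int_abs of_int_le_iff)
    then have "z \<in> ?F" by (auto simp: abs_le_iff minus_le_iff)
    moreover have "p = (\<chi> i. of_int (z i) / 2 ^ n)" by (simp add: vec_eq_iff z)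
    ultimately show "p \<in> (\<lambda>z. \<chi> i. of_int (z i) / 2 ^ n) ` ?F" by blast
  qed
  have fin: "finite ?F" by (intro finite_PiE) auto
  show "finite ?G" by (rule finite_subset[OF sub]) (use fin in simp)
  have "card ?G \<le> card ((\<lambda>z. (\<chi> i. of_int (z i) / 2 ^ n) :: real^3) ` ?F)"
    by (rule card_mono[OF _ sub]) (use fin in simp)
  also have "\<dots> \<le> card ?F" by (rule card_image_le[OF fin])
  also have "\<dots> = (2 ^ (n + 2) + 1) ^ 3"
    by (simp add: card_PiE nat_add_distrib nat_mult_distrib nat_power_eq)
  also have "\<dots> \<le> (8 * 2 ^ n) ^ 3" by (intro power_mono) auto
  also have "\<dots> = 512 * 8 ^ n"
    using power_mult[of "2::nat" 3 n] power_mult[of "2::nat" n 3] by (simp add: power_mult_distrib mult.commute)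
  finally show "card ?G \<le> 512 * 8 ^ n" .
qed

lemma norm_axis_real: "norm (axis j t :: real^3) = \<bar>t\<bar>"
  by (simp add: norm_eq_sqrt_inner inner_axis_axis)

lemma norm_add_axis_close:
  fixes p :: "real^3"
  shows "\<bar>norm (p + axis j t) - 1\<bar> \<le> \<bar>norm p - 1\<bar> + \<bar>t\<bar>"
    and "\<bar>norm (p - axis j t) - 1\<bar> \<le> \<bar>norm p - 1\<bar> + \<bar>t\<bar>"
  using norm_triangle_ineq3[of "p + axis j t" p] norm_triangle_ineq3[of "p - axis j t" p]
  by (auto simp: norm_axis_real)

lemma grid_add_axis:
  assumes "p \<in> grid n" "2 ^ n * t \<in> \<int>"
  shows "p + axis j t \<in> grid n" "p - axis j t \<in> grid n"
  using assms by (auto simp: grid_def axis_def algebra_simps)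

lemma grid_Suc: "p \<in> grid n \<Longrightarrow> p \<in> grid (Suc n)"
  by (auto simp: grid_def mult.assoc)

lemma Ints_half_shift:
  fixes x :: real
  assumes "2 * x \<in> \<int>" "x \<notin> \<int>"
  shows "x + 1 / 2 \<in> \<int>" "x - 1 / 2 \<in> \<int>"
proof -
  obtain m where m: "2 * x = of_int m" using assms(1) by (auto elim: Ints_cases)
  have "odd m"
  proof
    assume "even m"
    then obtain k where "m = 2 * k" by blast
    then have "x = of_int k" using m by simp
    then show False using assms(2) by simp
  qed
  then obtain k where "m = 2 * k + 1" by (elim oddE)
  then have "x + 1 / 2 = of_int (k + 1)" "x - 1 / 2 = of_int k" using m by simp_all
  then show "x + 1 / 2 \<in> \<int>" "x - 1 / 2 \<in> \<int>" by (metis Ints_of_int)+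
qed

text \<open>If all coordinates of \<open>p\<close> but possibly the \<open>j\<close>-th are even multiples of the fine mesh, the step from
  \<open>p\<close> in direction \<open>j\<close> is half of a coarse step, and its difference is half of the coarse one up to half
  of a second difference.  If an \<open>i\<close>-th coordinate of \<open>p\<close> with \<open>i \<noteq> j\<close> is an odd multiple of the fine
  mesh, then the difference at \<open>p\<close> is the mean of the differences at its two neighbours in direction \<open>i\<close>,
  up to second differences in direction \<open>i\<close>; this reduces the number of odd coordinates.

  The argument passes to neighbours, at distance at most three fine meshes in total.  The shell in which
  first differences are controlled therefore has to be larger on coarser grids, which is the reason for
  the term \<open>4 / 2 ^ n\<close> in its width.\<close>
lemma first_diff_refine:
  fixes f :: "real^3 \<Rightarrow> real" and n :: nat
  defines "h \<equiv> 1 / 2 ^ Suc n :: real"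
  assumes n: "n \<ge> 4"
    and second: "\<And>p j. p \<in> grid (Suc n) \<Longrightarrow> \<bar>norm p - 1\<bar> \<le> 1 / 2 \<Longrightarrow> \<bar>second_diff f (Suc n) p j\<bar> \<le> s"
    and first: "\<And>p j. p \<in> grid n \<Longrightarrow> \<bar>norm p - 1\<bar> \<le> 1 / 4 + 4 / 2 ^ n \<Longrightarrow>
      \<bar>f (p + axis j (1 / 2 ^ n)) - f p\<bar> \<le> d"
    and p: "p \<in> grid (Suc n)" "\<bar>norm p - 1\<bar> \<le> 1 / 4 + 4 / 2 ^ Suc n"
  shows "\<bar>f (p + axis j (1 / 2 ^ Suc n)) - f p\<bar> \<le> d / 2 + 3 * s"
proof -
  have h: "1 / 2 ^ n = 2 * h" "4 / 2 ^ n = 8 * h" "4 / 2 ^ Suc n = 4 * h" "h > 0"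
    by (simp_all add: h_def)
  have "(2::real) ^ 4 \<le> 2 ^ n" using n by (intro power_increasing) auto
  then have h32: "h \<le> 1 / 32" by (simp add: h_def field_simps)
  have hInts: "2 ^ Suc n * h \<in> \<int>" by (simp add: h_def)
  have sd: "second_diff f (Suc n) r i = f (r + axis i h) + f (r - axis i h) - 2 * f r" for r i
    by (simp add: second_diff_def h_def)
  have axis2: "axis j (2 * h) = axis j h + axis j h" for j :: 3
    by (simp add: axis_def vec_eq_iff)
  define odd_coords where "odd_coords q = {i. i \<noteq> j \<and> 2 ^ n * q $ i \<notin> \<int>}" for q :: "real^3"
  \<comment> \<open>Induction on the number \<open>m\<close> of odd coordinates.  The radius leaves room for the \<open>m\<close> moves to
    neighbours and for a last step along the axis \<open>j\<close>.\<close>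
  have main: "\<bar>f (q + axis j h) - f q\<bar> \<le> d / 2 + s / 2 + real m * s"
    if "q \<in> grid (Suc n)" "\<bar>norm q - 1\<bar> \<le> 1 / 4 + 8 * h - (real m + 1) * h" "card (odd_coords q) = m"
    for q m
    using that
  proof (induction m arbitrary: q)
    case 0
    have even: "2 ^ n * q $ i \<in> \<int>" if "i \<noteq> j" for i
      using 0(3) that by (auto simp: odd_coords_def)
    show ?case
    proof (cases "2 ^ n * q $ j \<in> \<int>")
      case True
      then have "2 ^ n * q $ i \<in> \<int>" for i using even by (cases "i = j") auto
      then have q: "q \<in> grid n" by (simp add: grid_def)
      have "\<bar>norm q - 1\<bar> \<le> 1 / 4 + 4 / 2 ^ n" using 0(2) h by simp
      from first[OF q this, of j] have 1: "\<bar>f (q + axis j h + axis j h) - f q\<bar> \<le> d"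
        by (simp add: h axis2 add.assoc)
      have "\<bar>norm (q + axis j h) - 1\<bar> \<le> 1 / 2"
        using norm_add_axis_close(1)[of q j h] 0(2) h h32 by simp
      from second[OF grid_add_axis(1)[OF 0(1) hInts] this, of j]
      have "\<bar>f (q + axis j h + axis j h) + f q - 2 * f (q + axis j h)\<bar> \<le> s"
        by (simp add: second_diff_def h_def)
      then show ?thesis using 1 by (simp add: abs_le_iff)
    next
      case False
      let ?r = "q - axis j h"
      have "2 * (2 ^ n * q $ j) \<in> \<int>" using 0(1) by (simp add: grid_def mult.assoc)
      from Ints_half_shift(2)[OF this False] have "2 ^ n * ?r $ j \<in> \<int>"
        by (simp add: axis_def right_diff_distrib h_def)
      moreover have "2 ^ n * ?r $ i \<in> \<int>" if "i \<noteq> j" for i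
        using even[OF that] that by (simp add: axis_def)
      ultimately have "2 ^ n * ?r $ i \<in> \<int>" for i by (cases "i = j") auto
      then have r: "?r \<in> grid n" by (simp add: grid_def)
      have "\<bar>norm ?r - 1\<bar> \<le> 1 / 4 + 4 / 2 ^ n"
        using norm_add_axis_close(2)[of q j h] 0(2) h by simp
      moreover have "?r + axis j (2 * h) = q + axis j h" by (simp add: axis2)
      ultimately have 1: "\<bar>f (q + axis j h) - f ?r\<bar> \<le> d"
        using first[OF r, of j] unfolding h(1) by metis
      have "\<bar>norm q - 1\<bar> \<le> 1 / 2" using 0(2) h h32 by simp
      from second[OF 0(1) this, of j]
      have "\<bar>f (q + axis j h) + f ?r - 2 * f q\<bar> \<le> s"
        by (simp add: second_diff_def h_def)
      then show ?thesis using 1 by (simp add: abs_le_iff)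
    qed
  next
    case (Suc m)
    have "odd_coords q \<noteq> {}" using Suc.prems(3) by auto
    then obtain i where i: "i \<in> odd_coords q" by blast
    then have ij: "i \<noteq> j" and odd: "2 ^ n * q $ i \<notin> \<int>" by (auto simp: odd_coords_def)
    have "2 * (2 ^ n * q $ i) \<in> \<int>" using Suc.prems(1) by (simp add: grid_def mult.assoc)
    note shift = Ints_half_shift[OF this odd]
    have i_ints: "2 ^ n * (q + axis i h) $ i \<in> \<int>" "2 ^ n * (q - axis i h) $ i \<in> \<int>"
      using shift by (simp_all add: axis_def distrib_left right_diff_distrib h_def)
    have "odd_coords (q + axis i h) = odd_coords q - {i}" "odd_coords (q - axis i h) = odd_coords q - {i}"
      using i_ints unfolding odd_coords_def by (auto simp: axis_def)
    then have card: "card (odd_coords (q + axis i h)) = m" "card (odd_coords (q - axis i h)) = m"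
      using Suc.prems(3) i by simp_all
    note g = grid_add_axis[OF Suc.prems(1) hInts, of i]
    have near: "\<bar>norm (q + axis i h) - 1\<bar> \<le> 1 / 4 + 8 * h - (real m + 1) * h"
      "\<bar>norm (q - axis i h) - 1\<bar> \<le> 1 / 4 + 8 * h - (real m + 1) * h"
      using norm_add_axis_close[of q i h] Suc.prems(2) h(4) by (simp_all add: algebra_simps)
    note IH = Suc.IH[OF g(1) near(1) card(1)] Suc.IH[OF g(2) near(2) card(2)]
    have mh: "real m * h \<ge> 0" using h by simp
    have qn: "\<bar>norm q - 1\<bar> \<le> 1 / 4 + 8 * h - 2 * h"
    proof -
      have "(real (Suc m) + 1) * h = real m * h + 2 * h" by (simp add: algebra_simps)
      then show ?thesis using Suc.prems(2) mh by linarith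
    qed
    have s1: "\<bar>second_diff f (Suc n) q i\<bar> \<le> s"
      using qn h32 h by (intro second Suc.prems(1)) simp
    have s2: "\<bar>second_diff f (Suc n) (q + axis j h) i\<bar> \<le> s"
      using norm_add_axis_close(1)[of q j h] qn h32 h
      by (intro second grid_add_axis Suc.prems(1) hInts) simp
    have "f (q + axis j h) - f q
      = ((f (q + axis i h + axis j h) - f (q + axis i h)) + (f (q - axis i h + axis j h) - f (q - axis i h))) / 2
        + (second_diff f (Suc n) q i - second_diff f (Suc n) (q + axis j h) i) / 2"
      by (simp add: sd algebra_simps) (simp add: field_simps)
    moreover have "real (Suc m) * s = real m * s + s" by (simp add: algebra_simps)
    moreover have "\<bar>(x + y) / 2 + (v - w) / 2\<bar> \<le> B + s"
      if "\<bar>x\<bar> \<le> B" "\<bar>y\<bar> \<le> B" "\<bar>v\<bar> \<le> s" "\<bar>w\<bar> \<le> s" for x y v w B :: real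
      using that by (simp add: abs_le_iff field_simps)
    note this[OF IH s1 s2]
    ultimately show ?case by simp
  qed
  have "odd_coords p \<subseteq> - {j}" by (auto simp: odd_coords_def)
  then have "card (odd_coords p) \<le> card (- {j})" by (rule card_mono[rotated]) simp
  then have c: "card (odd_coords p) \<le> 2" by (simp add: Compl_eq_Diff_UNIV)
  have "(real (card (odd_coords p)) + 1) * h \<le> 3 * h"
    using c h by (intro mult_right_mono) auto
  then have "\<bar>norm p - 1\<bar> \<le> 1 / 4 + 8 * h - (real (card (odd_coords p)) + 1) * h"
    using p(2) h(4) unfolding h(3) by linarith
  from main[OF p(1) this refl]
  have "\<bar>f (p + axis j h) - f p\<bar> \<le> d / 2 + s / 2 + real (card (odd_coords p)) * s" .
  moreover have "s \<ge> 0"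
  proof -
    have "0 \<le> \<bar>second_diff f (Suc n) p j\<bar>" by simp
    also have "\<dots> \<le> s" using p(2) h h32 by (intro second p(1)) simp
    finally show ?thesis .
  qed
  moreover from this have "real (card (odd_coords p)) * s \<le> 2 * s"
    using c by (intro mult_right_mono) auto
  ultimately show ?thesis by (simp add: h_def)
qed

text \<open>Iterating the recursion \<open>d (n + 1) \<le> d n / 2 + 3 * b ^ (n + 1)\<close> does not lose anything at
  \<open>a = 1 / 2\<close>, the Lipschitz case: there it says that the slopes \<open>2 ^ n * d n\<close> grow only by the terms of
  a convergent geometric series.\<close>
lemma first_diff_geometric:
  fixes f :: "real^3 \<Rightarrow> real" and a b :: real
  assumes ab: "0 < b" "b < a" "1 / 2 \<le> a"
    and second: "eventually (\<lambda>n. \<forall>p\<in>grid n. \<bar>norm p - 1\<bar> \<le> 1 / 2 \<longrightarrow> (\<forall>j. \<bar>second_diff f n p j\<bar> \<le> b ^ n)) sequentially"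
  shows "\<exists>N\<ge>4. \<exists>K\<ge>0. \<forall>n\<ge>N. \<forall>p\<in>grid n. \<bar>norm p - 1\<bar> \<le> 1 / 4 + 4 / 2 ^ n \<longrightarrow>
    (\<forall>j. \<bar>f (p + axis j (1 / 2 ^ n)) - f p\<bar> \<le> K * a ^ n)"
proof -
  obtain N0 where N0: "\<And>n p j. n \<ge> N0 \<Longrightarrow> p \<in> grid n \<Longrightarrow> \<bar>norm p - 1\<bar> \<le> 1 / 2 \<Longrightarrow> \<bar>second_diff f n p j\<bar> \<le> b ^ n"
    using second unfolding eventually_sequentially by blast
  define N where "N = max 4 N0"
  define q where "q = b / a"
  define c where "c = 3 * q / (1 - q)"
  have a: "a > 0" using ab by simp
  have q: "0 < q" "q < 1" using ab by (simp_all add: q_def)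
  have c: "c > 0" "c * (1 - q) = 3 * q" using q by (simp_all add: c_def)
  define G where "G = {p \<in> grid N. norm p \<le> 2}"
  have "finite G" unfolding G_def by (rule finite_grid_bounded)
  then have "bdd_above ((\<lambda>(p, j). \<bar>f (p + axis j (1 / 2 ^ N)) - f p\<bar>) ` (G \<times> UNIV))"
    by (intro bdd_above_finite) simp
  then obtain d0 where d0: "\<And>p j. p \<in> G \<Longrightarrow> \<bar>f (p + axis j (1 / 2 ^ N)) - f p\<bar> \<le> d0"
    unfolding bdd_above_def by (elim exE) (metis (no_types, lifting) SigmaI UNIV_I case_prod_conv image_eqI)
  \<comment> \<open>At level \<open>N\<close> only finitely many differences have to be bounded, by \<open>d0\<close>.\<close>
  define K where "K = c + \<bar>d0\<bar> / a ^ N"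
  \<comment> \<open>The deficit \<open>c * q ^ n\<close> is the tail of the geometric series of the errors still to come, which makes
    the bound inductive.\<close>
  have step: "\<forall>p\<in>grid n. \<bar>norm p - 1\<bar> \<le> 1 / 4 + 4 / 2 ^ n \<longrightarrow>
      (\<forall>j. \<bar>f (p + axis j (1 / 2 ^ n)) - f p\<bar> \<le> (K - c * q ^ n) * a ^ n)" if "n \<ge> N" for n
    using that
  proof (induction n rule: dec_induct)
    case base
    show ?case
    proof (intro ballI impI allI)
      fix p j assume p: "p \<in> grid N" "\<bar>norm p - 1\<bar> \<le> 1 / 4 + 4 / 2 ^ N"
      have "(2::real) ^ 4 \<le> 2 ^ N" by (intro power_increasing) (auto simp: N_def)
      then have "4 / 2 ^ N \<le> (1 / 4 :: real)" by (simp add: field_simps)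
      then have "norm p \<le> 2" using p(2) by linarith
      then have "p \<in> G" using p by (auto simp: G_def)
      then have "\<bar>f (p + axis j (1 / 2 ^ N)) - f p\<bar> \<le> \<bar>d0\<bar>" using d0[of p j] by simp
      also have "\<dots> = (\<bar>d0\<bar> / a ^ N) * a ^ N" using a by simp
      also have "\<dots> \<le> (K - c * q ^ N) * a ^ N"
        unfolding K_def using a q c power_le_one[of q N]
        by (intro mult_right_mono) (auto simp: mult_left_le)
      finally show "\<bar>f (p + axis j (1 / 2 ^ N)) - f p\<bar> \<le> (K - c * q ^ N) * a ^ N" .
    qed
  next
    case (step n)
    show ?case
    proof (intro ballI impI allI)
      fix p j assume p: "p \<in> grid (Suc n)" "\<bar>norm p - 1\<bar> \<le> 1 / 4 + 4 / 2 ^ Suc n"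
      have "\<bar>f (p + axis j (1 / 2 ^ Suc n)) - f p\<bar> \<le> (K - c * q ^ n) * a ^ n / 2 + 3 * b ^ Suc n"
      proof (rule first_diff_refine[OF _ _ _ p])
        show "4 \<le> n" using step(1) by (simp add: N_def)
        show "\<bar>second_diff f (Suc n) p j\<bar> \<le> b ^ Suc n"
          if "p \<in> grid (Suc n)" "\<bar>norm p - 1\<bar> \<le> 1 / 2" for p j
          using step(1) that by (intro N0) (auto simp: N_def)
      qed (use step.IH in blast)
      also have "b ^ Suc n = q ^ Suc n * a ^ Suc n"
        using a by (simp add: q_def power_mult_distrib[symmetric] del: power_Suc)
      also have "(K - c * q ^ n) * a ^ n / 2 \<le> (K - c * q ^ n) * a ^ Suc n"
      proof -
        have "c * q ^ n \<le> c" using c q power_le_one[of q n] by (simp add: mult_left_le)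
        also have "c \<le> K" using a by (simp add: K_def)
        finally have "0 \<le> (K - c * q ^ n) * a ^ n" using a by simp
        then have "(K - c * q ^ n) * a ^ n * (1 / 2) \<le> (K - c * q ^ n) * a ^ n * a"
          using ab by (intro mult_left_mono)
        then show ?thesis by (simp add: mult.assoc mult.commute[of a])
      qed
      also have "(K - c * q ^ n) * a ^ Suc n + 3 * (q ^ Suc n * a ^ Suc n) = (K - c * q ^ Suc n) * a ^ Suc n"
      proof -
        have "c * q ^ n = c * q ^ Suc n + 3 * q ^ Suc n"
          using arg_cong[OF c(2), of "\<lambda>x. x * q ^ n"] by (simp add: algebra_simps)
        then show ?thesis by (simp add: algebra_simps)
      qed
      finally show "\<bar>f (p + axis j (1 / 2 ^ Suc n)) - f p\<bar> \<le> (K - c * q ^ Suc n) * a ^ Suc n" by simp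
    qed
  qed
  have "K \<ge> 0" using c a by (simp add: K_def)
  have "(K - c * q ^ n) * a ^ n \<le> K * a ^ n" for n
    using c q a by (intro mult_right_mono) auto
  then have "\<forall>n\<ge>N. \<forall>p\<in>grid n. \<bar>norm p - 1\<bar> \<le> 1 / 4 + 4 / 2 ^ n \<longrightarrow>
    (\<forall>j. \<bar>f (p + axis j (1 / 2 ^ n)) - f p\<bar> \<le> K * a ^ n)"
    using step by (meson order.trans)
  moreover have "N \<ge> 4" by (simp add: N_def)
  ultimately show ?thesis using \<open>K \<ge> 0\<close> by blast
qed

text \<open>Grid points that differ by at most one mesh in each coordinate are joined by three steps along the
  axes.  A step in negative direction is bounded from its end point.\<close>
lemma adjacent_diff_le:
  fixes f :: "real^3 \<Rightarrow> real"
  defines "h \<equiv> \<lambda>n. 1 / 2 ^ n :: real"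
  assumes n: "n \<ge> 4"
    and first: "\<And>p j. p \<in> grid n \<Longrightarrow> \<bar>norm p - 1\<bar> \<le> 1 / 4 + 4 / 2 ^ n \<Longrightarrow>
      \<bar>f (p + axis j (1 / 2 ^ n)) - f p\<bar> \<le> d"
    and p: "p \<in> grid n" "\<bar>norm p - 1\<bar> \<le> 1 / 4"
    and q: "\<And>i. q $ i - p $ i \<in> {- h n, 0, h n}"
  shows "\<bar>f q - f p\<bar> \<le> 3 * d"
proof -
  have h: "h n > 0" "4 / 2 ^ n = 4 * h n" "2 ^ n * h n \<in> \<int>" by (simp_all add: h_def)
  have move: "r + axis i t \<in> grid n \<and> \<bar>norm (r + axis i t) - 1\<bar> \<le> 1 / 4 + (real m + 1) * h n \<and>
      \<bar>f (r + axis i t) - f r\<bar> \<le> d"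
    if r: "r \<in> grid n" "\<bar>norm r - 1\<bar> \<le> 1 / 4 + real m * h n" "m \<le> 3" "t \<in> {- h n, 0, h n}" for r i m t
  proof -
    have g: "r + axis i (h n) \<in> grid n" "r - axis i (h n) \<in> grid n"
      using grid_add_axis[OF r(1) h(3)] by auto
    have m3: "real m * h n \<le> 3 * h n" using r(3) h by (intro mult_right_mono) auto
    have ax: "axis i (- h n) = - axis i (h n)" "axis i (0::real) = 0" by (simp_all add: axis_def vec_eq_iff)
    have near: "\<bar>norm (r + axis i t) - 1\<bar> \<le> 1 / 4 + (real m + 1) * h n"
      using norm_add_axis_close(1)[of r i t] r h(1) by (auto simp: algebra_simps)
    have rn: "\<bar>norm r - 1\<bar> \<le> 1 / 4 + 4 / 2 ^ n" "\<bar>norm (r - axis i (h n)) - 1\<bar> \<le> 1 / 4 + 4 / 2 ^ n"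
      using norm_add_axis_close(2)[of r i "h n"] r(2) m3 h(1)
      unfolding h(2) abs_of_pos[OF h(1)] by linarith+
    have hn: "1 / 2 ^ n = h n" by (simp add: h_def)
    note b1 = first[OF r(1) rn(1), of i, unfolded hn] and b2 = first[OF g(2) rn(2), of i, unfolded hn]
    have "0 \<le> d" using b1 by (meson abs_ge_zero order.trans)
    then have "\<bar>f (r + axis i t) - f r\<bar> \<le> d"
      using r(4) b1 b2 by (auto simp: ax abs_minus_commute)
    then show ?thesis using near r(4) g r(1) by (auto simp: ax)
  qed
  let ?p1 = "p + axis 1 (q $ 1 - p $ 1)"
  let ?p2 = "?p1 + axis 2 (q $ 2 - p $ 2)"
  let ?p3 = "?p2 + axis 3 (q $ 3 - p $ 3)"
  have 1: "?p1 \<in> grid n" "\<bar>norm ?p1 - 1\<bar> \<le> 1 / 4 + real 1 * h n" "\<bar>f ?p1 - f p\<bar> \<le> d"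
    using move[of p 0, OF p(1) _ _ q, of 1] p(2) by auto
  have 2: "?p2 \<in> grid n" "\<bar>norm ?p2 - 1\<bar> \<le> 1 / 4 + real 2 * h n" "\<bar>f ?p2 - f ?p1\<bar> \<le> d"
    using move[of ?p1 1, OF 1(1,2) _ q, of 2] by auto
  have 3: "\<bar>f ?p3 - f ?p2\<bar> \<le> d"
    using move[of ?p2 2, OF 2(1,2) _ q, of 3] by auto
  have "?p3 = q" by (simp add: vec_eq_iff axis_def forall_3)
  then show ?thesis using 1(3) 2(3) 3 by simp
qed

lemma grid_floor_in_grid: "grid_floor n x \<in> grid n"
  by (simp add: grid_def grid_floor_def)

lemma grid_floor_close: "norm (grid_floor n x - x) \<le> 3 / 2 ^ n"
proof -
  have "\<bar>(grid_floor n x - x) $ i\<bar> \<le> 1 / 2 ^ n" for i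
  proof -
    have "(grid_floor n x - x) $ i = (of_int \<lfloor>2 ^ n * x $ i\<rfloor> - 2 ^ n * x $ i) / 2 ^ n"
      by (simp add: grid_floor_def field_simps)
    also have "\<bar>\<dots>\<bar> \<le> 1 / 2 ^ n"
    proof -
      have "\<bar>of_int \<lfloor>y\<rfloor> - y\<bar> \<le> 1" for y :: real by linarith
      then show ?thesis by (simp add: divide_right_mono)
    qed
    finally show ?thesis .
  qed
  then have "(\<Sum>i\<in>UNIV. \<bar>(grid_floor n x - x) $ i\<bar>) \<le> (\<Sum>i\<in>(UNIV :: 3 set). 1 / 2 ^ n)"
    by (intro sum_mono)
  then show ?thesis using norm_le_l1_cart[of "grid_floor n x - x"] by simp
qed

lemma grid_floor_norm:
  assumes "n \<ge> 4" "norm x = 1"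
  shows "\<bar>norm (grid_floor n x) - 1\<bar> \<le> 1 / 4"
proof -
  have "(2::real) ^ 4 \<le> 2 ^ n" using assms by (intro power_increasing) auto
  then have "3 / 2 ^ n \<le> (1 / 4 :: real)" by (simp add: field_simps)
  then show ?thesis
    using grid_floor_close[of n x] norm_triangle_ineq3[of "grid_floor n x" x]
    unfolding assms(2) by linarith
qed

lemma grid_floor_Suc_adjacent:
  "grid_floor (Suc n) x $ i - grid_floor n x $ i \<in> {- (1 / 2 ^ Suc n), 0, 1 / 2 ^ Suc n}"
proof -
  let ?y = "2 ^ n * x $ i"
  have "\<lfloor>2 * ?y\<rfloor> = 2 * \<lfloor>?y\<rfloor> \<or> \<lfloor>2 * ?y\<rfloor> = 2 * \<lfloor>?y\<rfloor> + 1" by linarith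
  then have "real_of_int \<lfloor>2 * ?y\<rfloor> = 2 * of_int \<lfloor>?y\<rfloor> \<or> real_of_int \<lfloor>2 * ?y\<rfloor> = 2 * of_int \<lfloor>?y\<rfloor> + 1"
    by auto
  moreover have "grid_floor (Suc n) x $ i - grid_floor n x $ i
      = (of_int \<lfloor>2 * ?y\<rfloor> - 2 * of_int \<lfloor>?y\<rfloor>) / 2 ^ Suc n"
    by (simp add: grid_floor_def field_simps)
  ultimately show ?thesis by auto
qed

lemma grid_floor_close_adjacent:
  assumes "norm (x - y) \<le> 1 / 2 ^ n"
  shows "grid_floor n x $ i - grid_floor n y $ i \<in> {- (1 / 2 ^ n), 0, 1 / 2 ^ n}"
proof -
  let ?x = "2 ^ n * x $ i" and ?y = "2 ^ n * y $ i"
  have "\<bar>x $ i - y $ i\<bar> \<le> 1 / 2 ^ n" using assms component_le_norm_cart[of "x - y" i] by simp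
  then have "\<bar>?x - ?y\<bar> \<le> 1" by (simp only: right_diff_distrib[symmetric] abs_mult) (simp add: field_simps)
  then have "\<lfloor>?x\<rfloor> - \<lfloor>?y\<rfloor> \<in> {-1, 0, 1}" by auto linarith
  moreover have "grid_floor n x $ i - grid_floor n y $ i = of_int (\<lfloor>?x\<rfloor> - \<lfloor>?y\<rfloor>) / 2 ^ n"
    by (simp add: grid_floor_def field_simps)
  ultimately show ?thesis by (elim insertE) auto
qed

lemma power_powr_swap: "0 \<le> (a::real) \<Longrightarrow> (a ^ n) powr k = (a powr k) ^ n"
  by (induction n) (simp_all add: powr_mult)

lemma geometric_steps_convergent:
  fixes u :: "nat \<Rightarrow> real" and a c :: real
  assumes a: "0 < a" "a < 1" and c: "c \<ge> 0"
    and step: "\<And>n. n \<ge> N \<Longrightarrow> \<bar>u (Suc n) - u n\<bar> \<le> c * a ^ n"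
  shows "convergent u" and "\<And>n. n \<ge> N \<Longrightarrow> \<bar>lim u - u n\<bar> \<le> c / (1 - a) * a ^ n"
proof -
  have tele: "\<bar>u (n + k) - u n\<bar> \<le> c / (1 - a) * (a ^ n - a ^ (n + k))" if "n \<ge> N" for n k
  proof (induction k)
    case (Suc k)
    have "\<bar>u (Suc (n + k)) - u (n + k)\<bar> \<le> c * a ^ (n + k)" using that by (intro step) simp
    moreover have "c * a ^ (n + k) = c / (1 - a) * (a ^ (n + k) - a ^ Suc (n + k))"
      using a by (simp add: field_simps)
    ultimately have "\<bar>u (Suc (n + k)) - u n\<bar>
        \<le> c / (1 - a) * (a ^ n - a ^ (n + k)) + c / (1 - a) * (a ^ (n + k) - a ^ Suc (n + k))"
      using Suc by linarith
    then show ?case by (simp add: algebra_simps)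
  qed simp
  have bound: "\<bar>u m - u n\<bar> \<le> c / (1 - a) * a ^ n" if "N \<le> n" "n \<le> m" for m n
  proof -
    have "\<bar>u m - u n\<bar> \<le> c / (1 - a) * (a ^ n - a ^ m)" using tele[of n "m - n"] that by simp
    also have "\<dots> \<le> c / (1 - a) * a ^ n" using a c by (intro mult_left_mono) auto
    finally show ?thesis .
  qed
  have "(\<lambda>n. c / (1 - a) * a ^ n) \<longlonglongrightarrow> c / (1 - a) * 0"
    using a by (intro tendsto_intros LIMSEQ_realpow_zero) auto
  then have small: "\<forall>e>0. \<exists>n0. \<forall>n\<ge>n0. c / (1 - a) * a ^ n < e"
    using order_tendstoD(2)[of _ "0::real" sequentially] by (auto simp: eventually_sequentially)
  have "Cauchy u"
  proof (rule metric_CauchyI)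
    fix e :: real assume "e > 0"
    then have "e / 2 > 0" by simp
    then obtain n0 where n0: "c / (1 - a) * a ^ n < e / 2" if "n \<ge> n0" for n
      using small by blast
    define B where "B = c / (1 - a) * a ^ max N n0"
    have "dist (u m) (u n) < e" if "m \<ge> max N n0" "n \<ge> max N n0" for m n
      using bound[of "max N n0" m] bound[of "max N n0" n] that n0[of "max N n0"]
      unfolding dist_real_def B_def[symmetric] by linarith
    then show "\<exists>M. \<forall>m\<ge>M. \<forall>n\<ge>M. dist (u m) (u n) < e" by blast
  qed
  then show conv: "convergent u" by (rule Cauchy_convergent)
  then have lim: "u \<longlonglongrightarrow> lim u" by (simp add: convergent_LIMSEQ_iff)
  show "\<bar>lim u - u n\<bar> \<le> c / (1 - a) * a ^ n" if "n \<ge> N" for n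
  proof (rule LIMSEQ_le_const2)
    show "(\<lambda>m. \<bar>u m - u n\<bar>) \<longlonglongrightarrow> \<bar>lim u - u n\<bar>" by (intro tendsto_intros lim)
    show "\<exists>k. \<forall>m\<ge>k. \<bar>u m - u n\<bar> \<le> c / (1 - a) * a ^ n" using bound that by blast
  qed
qed

lemma dyadic_scale:
  fixes d :: real
  assumes "0 < d" "d \<le> (1 / 2) ^ N"
  obtains n where "n \<ge> N" "(1 / 2) ^ Suc n < d" "d \<le> (1 / 2) ^ n"
proof -
  define m where "m = (LEAST m. (1 / 2) ^ m < d)"
  have ex: "\<exists>m. (1 / 2) ^ m < d" using assms(1) real_arch_pow_inv[of d "1 / 2"] by auto
  have m: "(1 / 2) ^ m < d" unfolding m_def by (rule LeastI_ex[OF ex])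
  have le: "d \<le> (1 / 2) ^ k" if "k < m" for k
    using not_less_Least[of k "\<lambda>m. (1 / 2) ^ m < d"] that by (simp add: m_def)
  have "m > N"
  proof (rule ccontr)
    assume "\<not> m > N"
    then have "(1 / 2) ^ N \<le> (1 / 2 :: real) ^ m" by (intro power_decreasing) auto
    then show False using m assms(2) by linarith
  qed
  then obtain n where n: "m = Suc n" "n \<ge> N" by (cases m) auto
  show ?thesis by (rule that[of n]) (use n m le in auto)
qed

text \<open>The values of \<open>f\<close> at the successive roundings of a point form a chain with geometrically decreasing
  steps.  For two points at distance about \<open>2 ^ - n\<close>, the two chains are compared at level \<open>n\<close>, where
  their members are adjacent.\<close>
lemma grid_limit_hoelder:
  fixes f :: "real^3 \<Rightarrow> real" and \<gamma> \<kappa> :: real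
  assumes \<gamma>: "0 < \<gamma>" "\<gamma> \<le> 1" "\<gamma> < \<kappa>"
    and second: "eventually (\<lambda>n. \<forall>p\<in>grid n. \<bar>norm p - 1\<bar> \<le> 1 / 2 \<longrightarrow>
      (\<forall>j. \<bar>second_diff f n p j\<bar> \<le> (2 powr - \<kappa>) ^ n)) sequentially"
  defines "g \<equiv> \<lambda>x. lim (\<lambda>n. f (grid_floor n x))"
  shows "\<And>x. x \<in> S2 \<Longrightarrow> (\<lambda>n. f (grid_floor n x)) \<longlonglongrightarrow> g x"
    and "\<exists>\<rho>>0. \<exists>K. \<forall>x\<in>S2. \<forall>y\<in>S2. norm (x - y) \<le> \<rho> \<longrightarrow> \<bar>g x - g y\<bar> \<le> K * norm (x - y) powr \<gamma>"
proof -
  define a b :: real where "a = 2 powr - \<gamma>" and "b = 2 powr - \<kappa>"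
  have ab: "0 < b" "b < a" "1 / 2 \<le> a" "a < 1"
  proof -
    have "2 powr - 1 \<le> (2::real) powr - \<gamma>" using \<gamma> by (intro powr_mono) auto
    then show "1 / 2 \<le> a" by (simp add: a_def powr_minus_divide)
    have "(2::real) powr - \<gamma> < 2 powr 0" using \<gamma> by (intro powr_less_mono) auto
    then show "a < 1" by (simp add: a_def)
    show "0 < b" "b < a" using \<gamma> by (simp_all add: a_def b_def)
  qed
  obtain N K where N: "N \<ge> 4" and K: "K \<ge> 0" and
    first0: "\<forall>n\<ge>N. \<forall>p\<in>grid n. \<bar>norm p - 1\<bar> \<le> 1 / 4 + 4 / 2 ^ n \<longrightarrow>
      (\<forall>j. \<bar>f (p + axis j (1 / 2 ^ n)) - f p\<bar> \<le> K * a ^ n)"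
    using first_diff_geometric[OF ab(1-3) second[folded b_def]] by (elim exE conjE) (rule that)
  have first: "\<bar>f (p + axis j (1 / 2 ^ n)) - f p\<bar> \<le> K * a ^ n"
    if "n \<ge> N" "p \<in> grid n" "\<bar>norm p - 1\<bar> \<le> 1 / 4 + 4 / 2 ^ n" for n p j
    using first0[rule_format, OF that] .
  have step: "\<bar>f (grid_floor (Suc n) x) - f (grid_floor n x)\<bar> \<le> 3 * K * a ^ n"
    if "n \<ge> N" "x \<in> S2" for n x
  proof -
    have "\<bar>f (grid_floor (Suc n) x) - f (grid_floor n x)\<bar> \<le> 3 * (K * a ^ Suc n)"
    proof (rule adjacent_diff_le[where n = "Suc n"])
      show "\<bar>norm (grid_floor n x) - 1\<bar> \<le> 1 / 4" using that N by (intro grid_floor_norm) auto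
      show "grid_floor n x \<in> grid (Suc n)" by (intro grid_Suc grid_floor_in_grid)
      show "4 \<le> Suc n" using that N by simp
      show "\<bar>f (p + axis j (1 / 2 ^ Suc n)) - f p\<bar> \<le> K * a ^ Suc n"
        if "p \<in> grid (Suc n)" "\<bar>norm p - 1\<bar> \<le> 1 / 4 + 4 / 2 ^ Suc n" for p j
        using \<open>n \<ge> N\<close> by (intro first that) simp
    qed (rule grid_floor_Suc_adjacent)
    also have "\<dots> \<le> 3 * (K * a ^ n)"
      using ab K power_decreasing[of n "Suc n" a] by (intro mult_left_mono) auto
    finally show ?thesis by simp
  qed
  define C where "C = 3 * K / (1 - a)"
  have C: "C \<ge> 0" using K ab by (simp add: C_def)
  have K3: "3 * K \<ge> 0" using K by simp
  note geom = geometric_steps_convergent[OF _ ab(4) K3 step]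
  show "(\<lambda>n. f (grid_floor n x)) \<longlonglongrightarrow> g x" if "x \<in> S2" for x
    using geom(1)[OF _ _ that] ab by (simp add: g_def convergent_LIMSEQ_iff)
  have close: "\<bar>g x - f (grid_floor n x)\<bar> \<le> C * a ^ n" if "n \<ge> N" "x \<in> S2" for n x
    using geom(2)[OF _ _ that(2) that(1)] ab by (simp add: g_def C_def)
  define L where "L = 2 * (2 * C + 3 * K)"
  have "\<bar>g x - g y\<bar> \<le> L * norm (x - y) powr \<gamma>"
    if xy: "x \<in> S2" "y \<in> S2" "norm (x - y) \<le> (1 / 2) ^ N" for x y
  proof (cases "x = y")
    case False
    then obtain n where n: "n \<ge> N" "(1 / 2) ^ Suc n < norm (x - y)" "norm (x - y) \<le> (1 / 2) ^ n"
      using dyadic_scale[of "norm (x - y)" N] xy(3) by auto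
    have "\<bar>f (grid_floor n x) - f (grid_floor n y)\<bar> \<le> 3 * (K * a ^ n)"
    proof (rule adjacent_diff_le[where n = n])
      show "\<bar>norm (grid_floor n y) - 1\<bar> \<le> 1 / 4" using xy n N by (intro grid_floor_norm) auto
      show "grid_floor n x $ i - grid_floor n y $ i \<in> {- (1 / 2 ^ n), 0, 1 / 2 ^ n}" for i
        using n(3) by (intro grid_floor_close_adjacent) (simp add: power_one_over)
      show "4 \<le> n" using n N by simp
    qed (use n in \<open>auto intro: first grid_floor_in_grid\<close>)
    then have "\<bar>g x - g y\<bar> \<le> 2 * C * a ^ n + 3 * K * a ^ n"
      using close[OF n(1) xy(1)] close[OF n(1) xy(2)] by linarith
    also have "\<dots> = (2 * C + 3 * K) * a ^ n" by (simp add: algebra_simps)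
    also have "\<dots> \<le> (2 * C + 3 * K) * (2 * norm (x - y) powr \<gamma>)"
    proof (rule mult_left_mono)
      have "a ^ n * (1 / 2) \<le> a ^ n * a" using ab by (intro mult_left_mono) auto
      then have "a ^ n \<le> 2 * a ^ Suc n" by (simp add: mult_ac)
      moreover have "a ^ Suc n = ((1 / 2) ^ Suc n) powr \<gamma>"
      proof -
        have a: "a = (1 / 2) powr \<gamma>" by (simp add: a_def powr_minus_divide powr_divide)
        show ?thesis unfolding a by (subst power_powr_swap) simp_all
      qed
      moreover have "((1 / 2) ^ Suc n) powr \<gamma> \<le> norm (x - y) powr \<gamma>"
        using n(2) \<gamma> by (intro powr_mono2) auto
      ultimately show "a ^ n \<le> 2 * norm (x - y) powr \<gamma>" by linarith
    qed (use C K in simp)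
    finally show ?thesis by (simp add: L_def algebra_simps)
  qed simp
  then show "\<exists>\<rho>>0. \<exists>K. \<forall>x\<in>S2. \<forall>y\<in>S2. norm (x - y) \<le> \<rho> \<longrightarrow> \<bar>g x - g y\<bar> \<le> K * norm (x - y) powr \<gamma>"
    by (intro exI[of _ "(1 / 2) ^ N"] conjI exI[of _ L]) auto
qed

section \<open>The radial projection onto the sphere\<close>

lemma norm_sgn_diff_le:
  fixes a c :: "'a :: real_normed_vector"
  assumes "c \<noteq> 0"
  shows "norm (sgn a - sgn c) \<le> 2 * norm (a - c) / norm c"
proof -
  have "norm c *\<^sub>R (sgn a - sgn c) = (a - c) + (norm c - norm a) *\<^sub>R sgn a"
    using assms by (cases "a = 0") (simp_all add: sgn_div_norm algebra_simps)
  then have "norm c * norm (sgn a - sgn c) = norm ((a - c) + (norm c - norm a) *\<^sub>R sgn a)"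
    by (metis abs_norm_cancel norm_scaleR)
  also have "\<dots> \<le> norm (a - c) + \<bar>norm c - norm a\<bar> * norm (sgn a)"
    using norm_triangle_ineq[of "a - c" "(norm c - norm a) *\<^sub>R sgn a"] by simp
  also have "\<dots> \<le> norm (a - c) + norm (a - c) * 1"
    using norm_triangle_ineq3[of c a]
    by (intro add_left_mono mult_mono) (auto simp: norm_sgn norm_minus_commute)
  finally show ?thesis using assms by (simp add: field_simps)
qed

text \<open>The lower bound is the triangle inequality.  For the upper bound, the parallelogram identity
  controls the square of \<open>norm (p + v) + norm (p - v)\<close>, and the difference to \<open>2 * norm p\<close> is a
  difference of squares divided by a sum that is at least \<open>4 * norm p\<close>.\<close>
lemma norm_second_diff_le:
  fixes p v :: "'a :: real_inner"
  assumes "p \<noteq> 0"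
  shows "0 \<le> norm (p + v) + norm (p - v) - 2 * norm p"
    and "norm (p + v) + norm (p - v) - 2 * norm p \<le> (norm v)\<^sup>2 / norm p"
proof -
  let ?A = "norm (p + v)" and ?B = "norm (p - v)" and ?P = "norm p"
  have P: "?P > 0" using assms by simp
  have "2 * ?P = norm ((p + v) + (p - v))" by (simp add: scaleR_2[symmetric])
  also have "\<dots> \<le> ?A + ?B" by (rule norm_triangle_ineq)
  finally show low: "0 \<le> ?A + ?B - 2 * ?P" by simp
  have "?A\<^sup>2 + ?B\<^sup>2 = 2 * ?P\<^sup>2 + 2 * (norm v)\<^sup>2"
    by (simp add: power2_norm_eq_inner inner_simps inner_commute)
  moreover have "(?A + ?B)\<^sup>2 \<le> 2 * (?A\<^sup>2 + ?B\<^sup>2)"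
    using sum_squares_bound[of ?A ?B] by (simp add: power2_eq_square algebra_simps)
  ultimately have "(?A + ?B - 2 * ?P) * (?A + ?B + 2 * ?P) \<le> 4 * (norm v)\<^sup>2"
    by (simp add: power2_eq_square algebra_simps)
  moreover have "(?A + ?B - 2 * ?P) * (4 * ?P) \<le> (?A + ?B - 2 * ?P) * (?A + ?B + 2 * ?P)"
    using low by (intro mult_left_mono) auto
  ultimately have "(?A + ?B - 2 * ?P) * ?P \<le> (norm v)\<^sup>2" by simp
  then show "?A + ?B - 2 * ?P \<le> (norm v)\<^sup>2 / ?P" using P by (simp add: field_simps)
qed

text \<open>The radial projection \<open>sgn\<close> is smooth away from the origin, so its second differences are of
  order \<open>norm v ^ 2\<close>.  With \<open>A = norm (p + v)\<close>, \<open>B = norm (p - v)\<close> and \<open>P = norm p\<close>, the second difference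
  is \<open>(1 / A + 1 / B - 2 / P) p + (1 / A - 1 / B) v\<close>, so that the estimates for the norm suffice.\<close>
lemma norm_sgn_second_diff_le:
  fixes p v :: "'a :: real_inner"
  assumes p: "norm p \<ge> 1 / 2" and v: "norm v \<le> 1 / 16"
  shows "norm (sgn (p + v) + sgn (p - v) - 2 *\<^sub>R sgn p) \<le> 32 * (norm v)\<^sup>2"
proof -
  define A B P h where "A = norm (p + v)" and "B = norm (p - v)" and "P = norm p" and "h = norm v"
  have h0: "h \<ge> 0" by (simp add: h_def)
  have PA: "\<bar>P - A\<bar> \<le> h" and PB: "\<bar>P - B\<bar> \<le> h"
    unfolding P_def A_def B_def h_def
    using norm_triangle_ineq3[of p "p + v"] norm_triangle_ineq3[of p "p - v"] by simp_all
  then have A: "A \<ge> 2 / 5" and B: "B \<ge> 2 / 5" and P: "P \<ge> 1 / 2"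
    using p v by (auto simp: P_def h_def)
  have iA: "1 / A \<le> 5 / 2" and iB: "1 / B \<le> 5 / 2" and iP: "1 / P \<le> 2"
    using A B P by (auto simp: field_simps)
  have iAB: "1 / (A * B) \<le> 25 / 4"
  proof -
    have "(1 / A) * (1 / B) \<le> (5 / 2) * (5 / 2)" using iA iB A B by (intro mult_mono) auto
    then show ?thesis by simp
  qed
  have AB: "\<bar>1 / A - 1 / B\<bar> \<le> 2 * h * (25 / 4)"
  proof -
    have "\<bar>1 / A - 1 / B\<bar> = \<bar>B - A\<bar> * (1 / (A * B))"
    proof -
      have "1 / A - 1 / B = (B - A) * (1 / (A * B))" using A B by (simp add: field_simps)
      then show ?thesis using A B by (simp add: abs_mult)
    qed
    also have "\<dots> \<le> 2 * h * (25 / 4)" using PA PB iAB A B by (intro mult_mono) auto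
    finally show ?thesis .
  qed
  have p0: "p \<noteq> 0" using p by auto
  note sd = norm_second_diff_le[OF p0, of v, folded A_def B_def P_def h_def]
  have "P * (1 / A + 1 / B - 2 / P) = (P - B) * (1 / B - 1 / A) - (A + B - 2 * P) * (1 / A)"
  proof -
    have "P * (a + b - q) = (P - B) * (b - a) - (A + B - 2 * P) * a"
      if "A * a = 1" "B * b = 1" "P * q = 2" for a b q using that by algebra
    then show ?thesis using A B P by simp
  qed
  then have "\<bar>P * (1 / A + 1 / B - 2 / P)\<bar> \<le> \<bar>(P - B) * (1 / B - 1 / A)\<bar> + \<bar>(A + B - 2 * P) * (1 / A)\<bar>"
    by (metis abs_triangle_ineq4)
  also have "\<dots> = \<bar>A + B - 2 * P\<bar> * (1 / A) + \<bar>P - B\<bar> * \<bar>1 / A - 1 / B\<bar>"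
    using A unfolding abs_mult abs_minus_commute[of "1 / B"] by simp
  also have "\<dots> \<le> (2 * h\<^sup>2) * (5 / 2) + h * (2 * h * (25 / 4))"
  proof (intro add_mono mult_mono iA PB AB)
    have "h\<^sup>2 * (1 / P) \<le> h\<^sup>2 * 2" using iP by (intro mult_left_mono) auto
    then show "\<bar>A + B - 2 * P\<bar> \<le> 2 * h\<^sup>2" using sd by simp
  qed (use h0 A in auto)
  finally have c: "\<bar>P * (1 / A + 1 / B - 2 / P)\<bar> \<le> 18 * h\<^sup>2"
    by (simp add: power2_eq_square)
  have "sgn (p + v) + sgn (p - v) - 2 *\<^sub>R sgn p
      = (1 / A + 1 / B - 2 / P) *\<^sub>R p + (1 / A - 1 / B) *\<^sub>R v"
    by (simp add: sgn_div_norm A_def B_def P_def algebra_simps inverse_eq_divide)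
  then have "norm (sgn (p + v) + sgn (p - v) - 2 *\<^sub>R sgn p)
      \<le> \<bar>1 / A + 1 / B - 2 / P\<bar> * P + \<bar>1 / A - 1 / B\<bar> * h"
    by (metis P_def h_def norm_scaleR norm_triangle_ineq)
  also have "\<bar>1 / A + 1 / B - 2 / P\<bar> * P = \<bar>P * (1 / A + 1 / B - 2 / P)\<bar>"
    using P by (simp add: abs_mult)
  also have "\<dots> + \<bar>1 / A - 1 / B\<bar> * h \<le> 18 * h\<^sup>2 + 2 * h * (25 / 4) * h"
    using c AB h0 by (intro add_mono mult_right_mono) auto
  also have "\<dots> \<le> 32 * h\<^sup>2" by (simp add: power2_eq_square)
  finally show ?thesis by (simp add: h_def)
qed

lemma sgn_in_S2: "norm p \<ge> 1 / 4 \<Longrightarrow> sgn p \<in> S2"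
  by (auto simp: norm_sgn)

text \<open>The points \<open>sgn (p + h e)\<close>, \<open>sgn (p - h e)\<close>, \<open>sgn p\<close> satisfy the conditions of the variance bound
  with \<open>\<delta> = 8 * h\<close>.  A slightly larger exponent \<open>\<kappa>'\<close> in the variance provides the gap that the
  Borel--Cantelli argument consumes.\<close>
lemma (in isotropic_spectral_field) AE_second_diff_small:
  fixes \<alpha> C \<kappa> :: real
  assumes decay: "\<And>l. l \<ge> 1 \<Longrightarrow> A l \<le> C * real l powr (- \<alpha>)"
    and \<kappa>: "0 < \<kappa>" "\<kappa> < 2" "\<kappa> < (\<alpha> - 2) / 2"
  shows "AE \<omega> in M. eventually (\<lambda>n. \<forall>p\<in>grid n. \<bar>norm p - 1\<bar> \<le> 1 / 2 \<longrightarrow>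
      (\<forall>j. \<bar>second_diff (\<lambda>p. T \<omega> (sgn p)) n p j\<bar> \<le> (2 powr - \<kappa>) ^ n)) sequentially"
proof -
  obtain \<kappa>' where \<kappa>': "\<kappa> < \<kappa>'" "\<kappa>' < min 2 ((\<alpha> - 2) / 2)"
    using dense[of \<kappa> "min 2 ((\<alpha> - 2) / 2)"] \<kappa> by auto
  obtain V where V: "V \<ge> 0" and var: "\<And>a b c \<delta>. a \<in> S2 \<Longrightarrow> b \<in> S2 \<Longrightarrow> c \<in> S2 \<Longrightarrow>
      0 < \<delta> \<Longrightarrow> \<delta> \<le> 1 / 2 \<Longrightarrow> norm (a - c) \<le> \<delta> \<Longrightarrow> norm (b - c) \<le> \<delta> \<Longrightarrow> norm (a + b - 2 *\<^sub>R c) \<le> \<delta>\<^sup>2 \<Longrightarrow>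
      (LINT \<omega>|M. (increment a b c \<omega>)\<^sup>2) \<le> V * (\<delta> powr \<kappa>')\<^sup>2"
    using variance_increment_le[OF decay, of \<kappa>'] \<kappa> \<kappa>' by auto
  define I :: "nat \<Rightarrow> ((real^3) \<times> 3) set"
    where "I n = (if n \<ge> 4 then {p \<in> grid n. \<bar>norm p - 1\<bar> \<le> 1 / 2} \<times> UNIV else {})" for n
  define X where "X n i = (case i of (p, j) \<Rightarrow>
      increment (sgn (p + axis j (1 / 2 ^ n))) (sgn (p - axis j (1 / 2 ^ n))) (sgn p))"
    for n and i :: "(real^3) \<times> 3"
  have sub: "{p \<in> grid n. \<bar>norm p - 1\<bar> \<le> 1 / 2} \<subseteq> {p \<in> grid n. norm p \<le> 2}" for n
  proof -
    have "norm p \<le> 2" if "\<bar>norm p - 1\<bar> \<le> 1 / 2" for p :: "real^3" using that by linarith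
    then show ?thesis by blast
  qed
  have fin: "finite {p \<in> grid n. \<bar>norm p - 1\<bar> \<le> 1 / 2}" for n
    by (rule finite_subset[OF sub finite_grid_bounded(1)])
  have card: "card (I n) \<le> 1536 * 8 ^ n" for n
    using card_mono[OF finite_grid_bounded(1) sub[of n]] finite_grid_bounded(2)[of n]
    by (simp add: I_def card_cartesian_product)
  have geo: "sgn (p + axis j h) \<in> S2 \<and> sgn (p - axis j h) \<in> S2 \<and> sgn p \<in> S2 \<and>
      norm (sgn (p + axis j h) - sgn p) \<le> 8 * h \<and> norm (sgn (p - axis j h) - sgn p) \<le> 8 * h \<and>
      norm (sgn (p + axis j h) + sgn (p - axis j h) - 2 *\<^sub>R sgn p) \<le> (8 * h)\<^sup>2 \<and> 8 * h \<le> 1 / 2 \<and> h > 0"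
    if "(p, j) \<in> I n" and h: "h = 1 / 2 ^ n" for p j n h
  proof -
    have n: "n \<ge> 4" and p: "\<bar>norm p - 1\<bar> \<le> 1 / 2" using that by (auto simp: I_def split: if_splits)
    have "(2::real) ^ 4 \<le> 2 ^ n" using n by (intro power_increasing) auto
    then have h16: "0 < h" "h \<le> 1 / 16" by (auto simp: h field_simps)
    have p2: "norm p \<ge> 1 / 2" using p by linarith
    then have p0: "p \<noteq> 0" by auto
    have ne: "norm (p + axis j h) \<ge> 1 / 4" "norm (p - axis j h) \<ge> 1 / 4"
      using norm_triangle_ineq3[of "p + axis j h" p] norm_triangle_ineq3[of "p - axis j h" p] p2 h16
      by (simp_all add: norm_axis_real)
    have "2 * h / norm p \<le> 2 * h / (1 / 2)" using p2 h16 by (intro divide_left_mono) auto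
    then have "norm (sgn (p + axis j h) - sgn p) \<le> 8 * h" "norm (sgn (p - axis j h) - sgn p) \<le> 8 * h"
      using norm_sgn_diff_le[OF p0, of "p + axis j h"] norm_sgn_diff_le[OF p0, of "p - axis j h"] h16
      by (simp_all add: norm_axis_real)
    moreover have "norm (sgn (p + axis j h) + sgn (p - axis j h) - 2 *\<^sub>R sgn p) \<le> 32 * h\<^sup>2"
      using norm_sgn_second_diff_le[OF p2, of "axis j h"] h16 by (simp add: norm_axis_real)
    moreover have "32 * h\<^sup>2 \<le> (8 * h)\<^sup>2" by (simp add: power_mult_distrib)
    ultimately show ?thesis using sgn_in_S2[OF ne(1)] sgn_in_S2[OF ne(2)] sgn_in_S2[of p] p2 h16
      by (intro conjI) linarith+
  qed
  have "AE \<omega> in M. eventually (\<lambda>n. \<forall>i\<in>I n. \<bar>X n i \<omega>\<bar> \<le> (2 powr - \<kappa>) ^ n) sequentially"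
  proof (rule gaussian_array_eventually_small[OF prob_space_axioms _ card])
    show "finite (I n)" for n using fin by (simp add: I_def)
    fix n i assume i: "i \<in> I n"
    obtain p j where pj: "i = (p, j)" by (cases i)
    define h :: real where "h = 1 / 2 ^ n"
    note g = geo[OF i[unfolded pj] h_def]
    show "normal_rv M (X n i)" unfolding X_def pj using g by (simp add: normal_increment h_def)
    show "(LINT \<omega>|M. X n i \<omega>) = 0" unfolding X_def pj using g by (simp add: mean_increment h_def)
    have "(LINT \<omega>|M. (X n i \<omega>)\<^sup>2) \<le> V * ((8 * h) powr \<kappa>')\<^sup>2"
      unfolding X_def pj prod.case h_def[symmetric] using g by (intro var) auto
    also have "(8 * h) powr \<kappa>' = 8 powr \<kappa>' * (2 powr - \<kappa>') ^ n"
    proof -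
      have "h = (1 / 2) ^ n" "(1 / 2) powr \<kappa>' = 2 powr - \<kappa>'"
        by (simp_all add: h_def power_one_over powr_divide powr_minus_divide)
      then show ?thesis by (simp add: powr_mult power_powr_swap)
    qed
    finally show "(LINT \<omega>|M. (X n i \<omega>)\<^sup>2) \<le> V * (8 powr \<kappa>')\<^sup>2 * ((2 powr - \<kappa>') ^ n)\<^sup>2"
      by (simp add: power_mult_distrib mult.assoc)
  qed (use V \<kappa>' in auto)
  then show ?thesis
  proof eventually_elim
    case (elim \<omega>)
    then show ?case using eventually_ge_at_top[of 4]
    proof eventually_elim
      case (elim n)
      show ?case
      proof (intro ballI impI allI)
        fix p j assume "p \<in> grid n" "\<bar>norm p - 1\<bar> \<le> 1 / 2"
        then have "(p, j) \<in> I n" using elim(2) by (simp add: I_def)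
        then have "\<bar>X n (p, j) \<omega>\<bar> \<le> (2 powr - \<kappa>) ^ n" using elim(1) by blast
        then show "\<bar>second_diff (\<lambda>p. T \<omega> (sgn p)) n p j\<bar> \<le> (2 powr - \<kappa>) ^ n"
          by (simp add: X_def second_diff_def increment_def)
      qed
    qed
  qed
qed

text \<open>A first-order increment \<open>T y - T x\<close> is half of the second-order increment with \<open>a = b = y\<close> and
  \<open>c = x\<close>.  The condition on \<open>a + b - 2 c\<close> then forces \<open>\<delta>\<close> to be of the order of the square root of the
  distance, which still gives a geometric rate.\<close>
lemma (in isotropic_spectral_field) AE_grid_floor_limit:
  fixes \<alpha> C :: real
  assumes decay: "\<And>l. l \<ge> 1 \<Longrightarrow> A l \<le> C * real l powr (- \<alpha>)"
    and \<alpha>: "\<alpha> > 2" and x: "x \<in> S2"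
  shows "AE \<omega> in M. (\<lambda>n. T \<omega> (sgn (grid_floor n x))) \<longlonglongrightarrow> T \<omega> x"
proof -
  obtain \<kappa> where \<kappa>: "0 < \<kappa>" "\<kappa> < min 2 ((\<alpha> - 2) / 2)"
    using dense[of 0 "min 2 ((\<alpha> - 2) / 2)"] \<alpha> by auto
  obtain V where V: "V \<ge> 0" and var: "\<And>a b c \<delta>. a \<in> S2 \<Longrightarrow> b \<in> S2 \<Longrightarrow> c \<in> S2 \<Longrightarrow>
      0 < \<delta> \<Longrightarrow> \<delta> \<le> 1 / 2 \<Longrightarrow> norm (a - c) \<le> \<delta> \<Longrightarrow> norm (b - c) \<le> \<delta> \<Longrightarrow> norm (a + b - 2 *\<^sub>R c) \<le> \<delta>\<^sup>2 \<Longrightarrow>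
      (LINT \<omega>|M. (increment a b c \<omega>)\<^sup>2) \<le> V * (\<delta> powr \<kappa>)\<^sup>2"
    using variance_increment_le[OF decay, of \<kappa>] \<kappa> by auto
  define y where "y n = sgn (grid_floor n x)" for n
  have nx: "norm x = 1" "sgn x = x" "x \<noteq> 0" using x by (auto simp: sgn_div_norm)
  have y: "y n \<in> S2" if "n \<ge> 4" for n
  proof -
    have "norm (grid_floor n x) \<ge> 1 / 4" using grid_floor_norm[OF that nx(1)] by linarith
    then show ?thesis unfolding y_def by (rule sgn_in_S2)
  qed
  have close: "norm (y n - x) \<le> 6 / 2 ^ n" for n
    using norm_sgn_diff_le[OF nx(3), of "grid_floor n x"] grid_floor_close[of n x] by (simp add: y_def nx)
  define I where "I n = (if n \<ge> 6 then {()} else {})" for n :: nat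
  define b where "b = (1 + 2 powr - (\<kappa> / 2)) / (2 :: real)"
  have a1: "2 powr - (\<kappa> / 2) < (1::real)" using powr_less_mono[of "- (\<kappa> / 2)" 0 "2::real"] \<kappa> by simp
  then have b: "2 powr - (\<kappa> / 2) < b" "0 < b" "b < 1" unfolding b_def by (auto intro: add_pos_pos)
  have "AE \<omega> in M. eventually (\<lambda>n. \<forall>i\<in>I n. \<bar>increment (y n) (y n) x \<omega>\<bar> \<le> b ^ n) sequentially"
  proof (rule gaussian_array_eventually_small[OF prob_space_axioms, where B = 1])
    show "finite (I n)" "card (I n) \<le> 1 * 8 ^ n" for n by (auto simp: I_def)
    fix n i assume "i \<in> I n"
    then have n: "n \<ge> 6" by (simp add: I_def split: if_splits)
    then have yn: "y n \<in> S2" by (intro y) simp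
    show "normal_rv M (increment (y n) (y n) x)" by (intro normal_increment yn x)
    show "(LINT \<omega>|M. increment (y n) (y n) x \<omega>) = 0" by (intro mean_increment yn x)
    \<comment> \<open>This makes \<open>\<delta> ^ 2 = 16 / 2 ^ n\<close>, which exceeds the bound \<open>12 / 2 ^ n\<close> for
      \<open>norm (y n + y n - 2 x)\<close>.  For \<open>n \<ge> 6\<close> it gives \<open>\<delta> \<le> 1 / 2\<close>.\<close>
    define \<delta> :: real where "\<delta> = 4 * (2 powr - (1 / 2)) ^ n"
    have "(2 powr - (1 / 2)) * (2 powr - (1 / 2)) = (1 / 2 :: real)"
      unfolding powr_add[symmetric] by (simp add: powr_minus_divide)
    then have "((2 powr - (1 / 2)) ^ n)\<^sup>2 = (1 / 2 :: real) ^ n"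
      by (simp only: power2_eq_square power_mult_distrib[symmetric])
    then have \<delta>2: "\<delta>\<^sup>2 = 16 / 2 ^ n"
      by (simp add: \<delta>_def power_mult_distrib power_one_over)
    have \<delta>0: "\<delta> > 0" by (simp add: \<delta>_def)
    have "(2::real) ^ 6 \<le> 2 ^ n" using n by (intro power_increasing) auto
    then have "\<delta>\<^sup>2 \<le> (1 / 2)\<^sup>2" unfolding \<delta>2 by (simp add: field_simps power2_eq_square)
    then have \<delta>1: "\<delta> \<le> 1 / 2" using \<delta>0 by (simp add: abs_le_square_iff[symmetric])
    have "\<delta> * \<delta> \<le> \<delta> * 1" using \<delta>0 \<delta>1 by (intro mult_left_mono) auto
    then have "16 / 2 ^ n \<le> \<delta>" using \<delta>2 by (simp add: power2_eq_square)
    moreover have "6 / 2 ^ n \<le> 16 / (2 ^ n :: real)" by (intro divide_right_mono) auto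
    ultimately have near: "norm (y n - x) \<le> \<delta>" using close[of n] by linarith
    have "y n + y n - 2 *\<^sub>R x = 2 *\<^sub>R (y n - x)" by (simp add: scaleR_2 algebra_simps)
    then have "norm (y n + y n - 2 *\<^sub>R x) = 2 * norm (y n - x)" by simp
    also have "\<dots> \<le> \<delta>\<^sup>2" using close[of n] unfolding \<delta>2 by (simp add: field_simps)
    finally have "(LINT \<omega>|M. (increment (y n) (y n) x \<omega>)\<^sup>2) \<le> V * (\<delta> powr \<kappa>)\<^sup>2"
      by (intro var yn x near \<delta>0 \<delta>1)
    also have "\<delta> powr \<kappa> = 4 powr \<kappa> * (2 powr - (\<kappa> / 2)) ^ n"
      by (simp add: \<delta>_def powr_mult power_powr_swap powr_powr)
    finally show "(LINT \<omega>|M. (increment (y n) (y n) x \<omega>)\<^sup>2) \<le> V * (4 powr \<kappa>)\<^sup>2 * ((2 powr - (\<kappa> / 2)) ^ n)\<^sup>2"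
      by (simp add: power_mult_distrib mult.assoc)
  qed (use V b in auto)
  then show ?thesis
  proof eventually_elim
    case (elim \<omega>)
    have "eventually (\<lambda>n. norm (T \<omega> (y n) - T \<omega> x) \<le> b ^ n) sequentially"
      using elim eventually_ge_at_top[of 6]
    proof eventually_elim
      case (elim n)
      then have "\<bar>increment (y n) (y n) x \<omega>\<bar> \<le> b ^ n" by (simp add: I_def)
      then show ?case by (simp add: increment_def)
    qed
    moreover have "(\<lambda>n. b ^ n) \<longlonglongrightarrow> 0" using b by (intro LIMSEQ_realpow_zero) auto
    ultimately have "(\<lambda>n. T \<omega> (y n) - T \<omega> x) \<longlonglongrightarrow> 0" by (rule Lim_null_comparison)
    then show ?case by (simp add: LIM_zero_iff y_def)
  qed
qed

section \<open>The continuous modification\<close>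

text \<open>If \<open>t\<close> is the angle between \<open>x\<close> and \<open>y\<close>, the chord has length \<open>2 * sin (t / 2)\<close>.\<close>
lemma norm_diff_le_geodesic_dist:
  assumes "x \<in> S2" "y \<in> S2"
  shows "norm (x - y) \<le> geodesic_dist x y"
proof -
  let ?t = "geodesic_dist x y"
  have n: "norm x = 1" "norm y = 1" using assms by auto
  have i: "- 1 \<le> x \<bullet> y" "x \<bullet> y \<le> 1"
    using Cauchy_Schwarz_ineq2[of x y] n by auto
  then have t: "cos ?t = x \<bullet> y" "0 \<le> ?t" by (simp_all add: geodesic_dist_def arccos_lbound)
  have "(norm (x - y))\<^sup>2 = 2 - 2 * cos (2 * (?t / 2))"
    using n t by (simp add: power2_norm_eq_inner inner_simps inner_commute norm_eq_1)
  also have "\<dots> = (2 * sin (?t / 2))\<^sup>2"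
    unfolding cos_double_sin by (simp add: power_mult_distrib)
  also have "\<dots> \<le> ?t\<^sup>2"
    using abs_sin_x_le_abs_x[of "?t / 2"] t by (intro abs_le_square_iff[THEN iffD1]) (simp add: abs_mult)
  finally show ?thesis using t by (simp add: power2_le_iff_abs_le)
qed

text \<open>By compactness a locally uniform Hoelder bound makes \<open>g\<close> bounded above, by \<open>B\<close> say.  On the values
  of \<open>g\<close> the exponential has Lipschitz constant \<open>exp B\<close>, which settles points at distance at most \<open>\<rho>\<close>; for
  the others the values themselves are at most \<open>exp B\<close>.\<close>
lemma hoelder_continuous_exp:
  fixes g :: "real^3 \<Rightarrow> real"
  assumes \<gamma>: "\<gamma> > 0" and \<rho>: "\<rho> > 0"
    and loc: "\<And>x y. x \<in> S2 \<Longrightarrow> y \<in> S2 \<Longrightarrow> norm (x - y) \<le> \<rho> \<Longrightarrow> \<bar>g x - g y\<bar> \<le> K * norm (x - y) powr \<gamma>"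
  shows "hoelder_continuous \<gamma> (\<lambda>x. exp (g x))"
proof -
  have "compact S2" by simp
  then obtain F where F: "F \<subseteq> S2" "finite F" "S2 \<subseteq> (\<Union>c\<in>F. ball c \<rho>)"
  proof (rule compactE_image)
    show "open (ball c \<rho>)" for c :: "real^3" by simp
    show "S2 \<subseteq> (\<Union>c\<in>S2. ball c \<rho>)" using \<rho> by force
  qed
  have "bdd_above (g ` F)" using F(2) by (intro bdd_above_finite) simp
  then obtain B0 where B0: "\<And>c. c \<in> F \<Longrightarrow> g c \<le> B0" unfolding bdd_above_def by auto
  define B where "B = B0 + \<bar>K\<bar> * \<rho> powr \<gamma>"
  have B: "g x \<le> B" if x: "x \<in> S2" for x
  proof -
    obtain c where c: "c \<in> F" "norm (x - c) < \<rho>"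
      using x F(3) by (auto simp: dist_norm norm_minus_commute)
    have "\<bar>g x - g c\<bar> \<le> K * norm (x - c) powr \<gamma>" using c F(1) x by (intro loc) auto
    also have "\<dots> \<le> \<bar>K\<bar> * \<rho> powr \<gamma>" using c \<gamma> by (intro mult_mono powr_mono2) auto
    finally show ?thesis using B0[OF c(1)] by (simp add: B_def)
  qed
  have exp_lip: "\<bar>exp u - exp v\<bar> \<le> exp B * \<bar>u - v\<bar>" if "u \<le> B" "v \<le> B" for u v
  proof -
    have *: "exp s - exp r \<le> exp B * (s - r)" if "r \<le> s" "s \<le> B" for r s
    proof -
      have "1 - exp (r - s) \<le> s - r" using exp_ge_add_one_self[of "r - s"] by linarith
      then have "exp s * (1 - exp (r - s)) \<le> exp B * (s - r)"
        using that by (intro mult_mono) auto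
      moreover have "exp s - exp r = exp s * (1 - exp (r - s))" by (simp add: right_diff_distrib mult_exp_exp)
      ultimately show ?thesis by simp
    qed
    show ?thesis
      using *[of u v] *[of v u] that by (cases "u \<le> v") (auto simp: abs_if)
  qed
  show ?thesis unfolding hoelder_continuous_def
  proof (intro exI ballI)
    fix x y assume xy: "x \<in> S2" "y \<in> S2"
    have "\<bar>exp (g x) - exp (g y)\<bar> \<le> exp B * (\<bar>K\<bar> + \<rho> powr - \<gamma>) * norm (x - y) powr \<gamma>"
    proof (cases "norm (x - y) \<le> \<rho>")
      case True
      have "\<bar>exp (g x) - exp (g y)\<bar> \<le> exp B * \<bar>g x - g y\<bar>" by (intro exp_lip B xy)
      also have "\<dots> \<le> exp B * (K * norm (x - y) powr \<gamma>)" using loc[OF xy True] by simp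
      also have "\<dots> \<le> exp B * ((\<bar>K\<bar> + \<rho> powr - \<gamma>) * norm (x - y) powr \<gamma>)"
        by (intro mult_left_mono mult_right_mono) (auto intro: add_increasing2)
      finally show ?thesis by (simp add: mult.assoc)
    next
      case False
      have "\<rho> powr - \<gamma> * \<rho> powr \<gamma> = 1" using \<rho> by (simp add: powr_minus)
      moreover have "\<rho> powr - \<gamma> * \<rho> powr \<gamma> \<le> (\<bar>K\<bar> + \<rho> powr - \<gamma>) * norm (x - y) powr \<gamma>"
        using False \<rho> \<gamma> by (intro mult_mono powr_mono2) auto
      ultimately have "exp B * 1 \<le> exp B * ((\<bar>K\<bar> + \<rho> powr - \<gamma>) * norm (x - y) powr \<gamma>)"
        by (intro mult_left_mono) auto
      moreover have "0 < exp (g x)" "exp (g x) \<le> exp B" "0 < exp (g y)" "exp (g y) \<le> exp B"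
        using B xy by auto
      then have "\<bar>exp (g x) - exp (g y)\<bar> \<le> exp B" by linarith
      ultimately show ?thesis unfolding mult.assoc by linarith
    qed
    also have "\<dots> \<le> exp B * (\<bar>K\<bar> + \<rho> powr - \<gamma>) * geodesic_dist x y powr \<gamma>"
      using \<gamma> norm_diff_le_geodesic_dist[OF xy] by (intro mult_left_mono powr_mono2) auto
    finally show "\<bar>exp (g x) - exp (g y)\<bar> \<le> exp B * (\<bar>K\<bar> + \<rho> powr - \<gamma>) * geodesic_dist x y powr \<gamma>" .
  qed
qed

lemma borel_measurable_grid_floor [measurable]: "grid_floor n \<in> borel_measurable borel"
proof -
  have "grid_floor n = (\<lambda>x. \<Sum>i\<in>UNIV. (of_int \<lfloor>2 ^ n * (x \<bullet> axis i 1)\<rfloor> / 2 ^ n) *\<^sub>R axis i 1)"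
    unfolding inner_axis by (simp add: fun_eq_iff vec_eq_iff grid_floor_def axis_def if_distrib cong: if_cong)
  also have "\<dots> \<in> borel_measurable borel" by measurable
  finally show ?thesis .
qed

lemma borel_measurable_sgn_euclidean [measurable]:
  "(sgn :: 'a :: euclidean_space \<Rightarrow> 'a) \<in> borel_measurable borel"
  unfolding sgn_div_norm[abs_def] by measurable

lemma measurable_sgn_grid_floor:
  assumes "n \<ge> 4"
  shows "(\<lambda>x. sgn (grid_floor n x)) \<in> measurable (restrict_space borel S2) (restrict_space borel S2)"
proof (rule measurable_restrict_space2)
  show "(\<lambda>x. sgn (grid_floor n x)) \<in> space (restrict_space borel S2) \<rightarrow> S2"
  proof
    fix x assume "x \<in> space (restrict_space borel S2)"
    then have "norm x = 1" by (simp add: space_restrict_space)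
    from grid_floor_norm[OF assms this] have "norm (grid_floor n x) \<ge> 1 / 4" by linarith
    then show "sgn (grid_floor n x) \<in> S2" by (rule sgn_in_S2)
  qed
  show "(\<lambda>x. sgn (grid_floor n x)) \<in> borel_measurable (restrict_space borel S2)"
    by (intro measurable_restrict_space1) measurable
qed

text \<open>Rounding is measurable, so a limit of values at roundings is jointly measurable.  The shift by 4
  keeps the rounded points away from the origin, whose projection is not on the sphere.\<close>
lemma random_field_limit:
  assumes T: "random_field M T" and N: "N \<in> sets M"
  shows "random_field M (\<lambda>\<omega> x. if \<omega> \<in> N then 1 else exp (lim (\<lambda>n. T \<omega> (sgn (grid_floor (n + 4) x)))))"
proof -
  let ?R = "restrict_space borel S2 :: (real^3) measure"
  have "(\<lambda>z. T (fst z) (sgn (grid_floor (n + 4) (snd z)))) \<in> borel_measurable (M \<Otimes>\<^sub>M ?R)" for n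
  proof -
    have [measurable]: "(\<lambda>x. sgn (grid_floor (n + 4) x)) \<in> measurable ?R ?R"
      by (rule measurable_sgn_grid_floor) simp
    have "(\<lambda>z. (fst z, sgn (grid_floor (n + 4) (snd z)))) \<in> measurable (M \<Otimes>\<^sub>M ?R) (M \<Otimes>\<^sub>M ?R)"
      by (intro measurable_Pair measurable_fst measurable_compose[OF measurable_snd]) measurable
    from measurable_compose[OF this T[unfolded random_field_def]] show ?thesis by simp
  qed
  note [measurable] = this N
  have "(\<lambda>z. if fst z \<in> N then 1 else exp (lim (\<lambda>n. T (fst z) (sgn (grid_floor (n + 4) (snd z))))))
      \<in> borel_measurable (M \<Otimes>\<^sub>M ?R)"
    by measurable
  then show ?thesis by (simp add: random_field_def case_prod_beta)
qed

theorem corollary6p2: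
  fixes M :: "'w measure" and T :: "'w sphere_field"
    and A :: "nat \<Rightarrow> real" and \<alpha> C :: real
  assumes "prob_space M"
    and "isotropic_gaussian_field M T"
    and "angular_power_spectrum M T A"
    and "\<alpha> > 2"
    and "\<And>l. l \<ge> 1 \<Longrightarrow> A l \<le> C * real l powr (- \<alpha>)"
  shows "\<exists>S. modification M (\<lambda>\<omega> x. exp (T \<omega> x)) S \<and>
    (\<forall>\<omega>\<in>space M. \<forall>\<gamma>. 0 < \<gamma> \<and> \<gamma> < (\<alpha> - 2) / 2 \<and> \<gamma> \<le> 1 \<longrightarrow> hoelder_continuous \<gamma> (S \<omega>))"
proof -
  interpret prob_space M by fact
  interpret isotropic_spectral_field M T A by unfold_locales fact+
  define f where "f \<omega> p = T \<omega> (sgn p)" for \<omega> p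
  define small where "small \<kappa> \<omega> \<longleftrightarrow> eventually (\<lambda>n. \<forall>p\<in>grid n. \<bar>norm p - 1\<bar> \<le> 1 / 2 \<longrightarrow>
    (\<forall>j. \<bar>second_diff (f \<omega>) n p j\<bar> \<le> (2 powr - \<kappa>) ^ n)) sequentially" for \<kappa> :: real and \<omega>
  \<comment> \<open>Rational exponents, so that a single null set \<open>N\<close> serves all of them.\<close>
  define R where "R = {\<kappa> \<in> \<rat>. 0 < \<kappa> \<and> \<kappa> < 2 \<and> \<kappa> < (\<alpha> - 2) / 2}"
  have "R \<subseteq> \<rat>" by (auto simp: R_def)
  then have "countable R" by (rule countable_subset) (rule countable_rat)
  moreover have "AE \<omega> in M. small \<kappa> \<omega>" if "\<kappa> \<in> R" for \<kappa>
    unfolding small_def f_def using that by (intro AE_second_diff_small[OF assms(5)]) (auto simp: R_def)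
  ultimately have "AE \<omega> in M. \<forall>\<kappa>\<in>R. small \<kappa> \<omega>" by (simp add: AE_ball_countable)
  then obtain N where N: "{\<omega> \<in> space M. \<not> (\<forall>\<kappa>\<in>R. small \<kappa> \<omega>)} \<subseteq> N" "emeasure M N = 0" "N \<in> sets M"
    by (rule AE_E)
  have good: "small \<kappa> \<omega>" if "\<omega> \<in> space M" "\<omega> \<notin> N" "\<kappa> \<in> R" for \<omega> \<kappa>
    using N(1) that by blast
  define g where "g \<omega> x = lim (\<lambda>n. f \<omega> (grid_floor n x))" for \<omega> x
  define S where "S = (\<lambda>\<omega> x. if \<omega> \<in> N then 1 else exp (lim (\<lambda>n. T \<omega> (sgn (grid_floor (n + 4) x)))))"
  have exponent: "\<exists>\<kappa>\<in>R. \<gamma> < \<kappa>" if "0 < \<gamma>" "\<gamma> < (\<alpha> - 2) / 2" "\<gamma> \<le> 1" for \<gamma>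
    using Rats_dense_in_real[of \<gamma> "min 2 ((\<alpha> - 2) / 2)"] that by (force simp: R_def)
  obtain \<gamma>0 where \<gamma>0: "0 < \<gamma>0" "\<gamma>0 < (\<alpha> - 2) / 2" "\<gamma>0 \<le> 1"
    using dense[of 0 "min 1 ((\<alpha> - 2) / 2)"] assms(4) by auto
  have lim_g: "(\<lambda>n. f \<omega> (grid_floor n x)) \<longlonglongrightarrow> g \<omega> x"
    if "\<omega> \<in> space M" "\<omega> \<notin> N" "x \<in> S2" for \<omega> x
  proof -
    obtain \<kappa> where \<kappa>: "\<kappa> \<in> R" "\<gamma>0 < \<kappa>" using exponent[OF \<gamma>0] by blast
    show ?thesis unfolding g_def
      by (rule grid_limit_hoelder(1)[OF \<gamma>0(1,3) \<kappa>(2) good[OF that(1,2) \<kappa>(1), unfolded small_def] that(3)])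
  qed
  have S_eq: "S \<omega> x = exp (g \<omega> x)" if "\<omega> \<in> space M" "\<omega> \<notin> N" "x \<in> S2" for \<omega> x
  proof -
    have "(\<lambda>n. f \<omega> (grid_floor (n + 4) x)) \<longlonglongrightarrow> g \<omega> x"
      using lim_g[OF that] by (rule LIMSEQ_ignore_initial_segment)
    then have "lim (\<lambda>n. T \<omega> (sgn (grid_floor (n + 4) x))) = g \<omega> x"
      unfolding f_def by (rule limI)
    then show ?thesis using that(2) by (simp add: S_def)
  qed
  have T: "random_field M T"
    using assms(2) by (simp add: isotropic_gaussian_field_def gaussian_field_def)
  have S: "random_field M S" unfolding S_def by (rule random_field_limit[OF T N(3)])
  have "measure M {\<omega> \<in> space M. S \<omega> x = exp (T \<omega> x)} = 1" if x: "x \<in> S2" for x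
  proof -
    have [measurable]: "(\<lambda>\<omega>. S \<omega> x) \<in> borel_measurable M"
    proof -
      have "(\<lambda>\<omega>. (\<omega>, x)) \<in> measurable M (M \<Otimes>\<^sub>M restrict_space borel S2)"
        using x by (intro measurable_Pair2') (simp add: space_restrict_space)
      from measurable_compose[OF this S[unfolded random_field_def]] show ?thesis by simp
    qed
    have [measurable]: "(\<lambda>\<omega>. T \<omega> x) \<in> borel_measurable M"
      using integrable_T(1)[OF x] by simp
    have "AE \<omega> in M. \<omega> \<notin> N" using N by (intro AE_not_in) (simp add: null_sets_def)
    moreover have "AE \<omega> in M. (\<lambda>n. T \<omega> (sgn (grid_floor n x))) \<longlonglongrightarrow> T \<omega> x"
      by (rule AE_grid_floor_limit[OF assms(5,4) x])
    ultimately have "AE \<omega> in M. S \<omega> x = exp (T \<omega> x)"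
      using AE_space
    proof eventually_elim
      case (elim \<omega>)
      have "g \<omega> x = T \<omega> x"
        using lim_g[OF elim(3,1) x] elim(2) unfolding f_def by (rule LIMSEQ_unique)
      then show ?case using S_eq[OF elim(3,1) x] by simp
    qed
    then show ?thesis by (subst prob_Collect_eq_1) measurable
  qed
  then have "modification M (\<lambda>\<omega> x. exp (T \<omega> x)) S"
    using S by (simp add: modification_def)
  moreover have "hoelder_continuous \<gamma> (S \<omega>)"
    if \<omega>: "\<omega> \<in> space M" and \<gamma>: "0 < \<gamma>" "\<gamma> < (\<alpha> - 2) / 2" "\<gamma> \<le> 1" for \<omega> \<gamma>
  proof (cases "\<omega> \<in> N")
    case True
    then show ?thesis unfolding hoelder_continuous_def S_def by (intro exI[of _ 0]) simp
  next
    case False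
    obtain \<kappa> where \<kappa>: "\<kappa> \<in> R" "\<gamma> < \<kappa>" using exponent[OF \<gamma>] by blast
    have "\<exists>\<rho>>0. \<exists>K. \<forall>x\<in>S2. \<forall>y\<in>S2. norm (x - y) \<le> \<rho> \<longrightarrow>
        \<bar>g \<omega> x - g \<omega> y\<bar> \<le> K * norm (x - y) powr \<gamma>"
      unfolding g_def
      by (rule grid_limit_hoelder(2)[OF \<gamma>(1,3) \<kappa>(2) good[OF \<omega> False \<kappa>(1), unfolded small_def]])
    then obtain \<rho> K where "\<rho> > 0" and
      "\<forall>x\<in>S2. \<forall>y\<in>S2. norm (x - y) \<le> \<rho> \<longrightarrow> \<bar>g \<omega> x - g \<omega> y\<bar> \<le> K * norm (x - y) powr \<gamma>"
      by blast
    then have "hoelder_continuous \<gamma> (\<lambda>x. exp (g \<omega> x))"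
      using \<gamma>(1) by (intro hoelder_continuous_exp[where \<rho> = \<rho> and K = K]) blast+
    moreover have "hoelder_continuous \<gamma> (S \<omega>) \<longleftrightarrow> hoelder_continuous \<gamma> (\<lambda>x. exp (g \<omega> x))"
      unfolding hoelder_continuous_def
      by (intro ex_cong1 ball_cong refl) (simp only: S_eq[OF \<omega> False])
    ultimately show ?thesis by simp
  qed
  ultimately show ?thesis by blast
qed

end
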